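(* Let $n\geq 1$, $\nu\geq 1$, let $w=x_0x_{q_1}x_{q_1+q_2}$ where $0\leq q_1,q_2<n$ (subscripts mod $n$), and suppose that the cyclic presentation $P_n(w)$ is irreducible. Then $P_n(w)$ is $(3,3,\nu)$-special if and only if either: (a) $n=7$, $\nu=1$, and $\{q_1,\ q_2,\ (-q_1-q_2)\bmod 7\}=\{1,2,4\}$ or $\{3,5,6\}$; or (b) $n=21$, $\nu=3$, and $\{q_1,\ q_2,\ (-q_1-q_2)\bmod 21\}=\{1,4,16\}$, $\{2,8,11\}$, $\{5,17,20\}$, or $\{10,13,19\}$.
   Context: Cyclic presentations: $F_n$ is the free group with basis $x_0,\ldots,x_{n-1}$ and $\theta:F_n\to F_n$ is the automorphism $\theta(x_i)=x_{i+1}$ (subscripts mod $n$). For a cyclically reduced word $w\in F_n$, $P_n(w)=\langle x_0,\ldots,x_{n-1}\mid w,\theta(w),\ldots,\theta^{n-1}(w)\rangle$. $P_n(w)$ is irreducible if the greatest common divisor of $n$ and the subscripts of the generators appearing in $w$ is $1$. Star graph: let $\tilde R$ be the set of all cyclic permutations of elements of $R\cup R^{-1}$. The star graph of $\langle X\mid R\rangle$ (all relators cyclically reduced) is the undirected graph, possibly with multiple edges, with vertex set $X\cup X^{-1}$ and an edge joining $x$ and $y$ for each distinct word of the form $xy^{-1}u$ in $\tilde R$, where the edges corresponding to the inverse pair $xy^{-1}u$, $yx^{-1}u^{-1}$ are identified. Special presentations: let $m\geq 2$, $k\geq 3$, $\nu\geq 1$. A finite presentation $\langle X\mid R\rangle$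 is $(m,k,\nu)$-special if (a) its star graph has exactly $\nu$ connected components, which are pairwise isomorphic, each a connected bipartite graph of diameter $m$ and girth $2m$ in which each vertex has degree at least $3$; (b) each relator has length $k$; (c) if $m=2$ then $k\geq 4$. Girth is the length of a shortest closed path in which consecutive edges are never equal (so a pair of parallel edges gives such a path of length $2$). *)

theory Defs
  imports "Graph_Theory.Graph_Theory" "HOL-Library.Extended_Nat"
begin

section \<open>Words and presentations\<close>

text \<open>The letter \<open>(x, True)\<close> stands for the generator \<open>x\<close>, the letter \<open>(x, False)\<close> for its formal
  inverse. Elements of a free group are represented by reduced words.\<close>

type_synonym 'a letter = "'a \<times> bool"

definition inv_letter :: "'a letter \<Rightarrow> 'a letter" where
  "inv_letter l = (fst l, \<not> snd l)"

definition inv_word :: "'a letter list \<Rightarrow> 'a letter list" where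
  "inv_word w = rev (map inv_letter w)"

definition reduced :: "'a letter list \<Rightarrow> bool" where
  "reduced w \<longleftrightarrow> (\<forall>i. Suc i < length w \<longrightarrow> w ! Suc i \<noteq> inv_letter (w ! i))"

definition cyclically_reduced :: "'a letter list \<Rightarrow> bool" where
  "cyclically_reduced w \<longleftrightarrow> (\<forall>i. reduced (rotate i w))"

record 'a presentation =
  gens :: "'a set"
  rels :: "'a letter list set"

definition finite_presentation :: "'a presentation \<Rightarrow> bool" where
  "finite_presentation P \<longleftrightarrow> finite (gens P) \<and> finite (rels P) \<and>
     (\<forall>r \<in> rels P. fst ` set r \<subseteq> gens P \<and> cyclically_reduced r)"


section \<open>Cyclic presentations\<close>

text \<open>The generator \<open>x\<^sub>i\<close> (\<open>0 \<le> i < n\<close>) is the natural number \<open>i\<close>.\<close>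

definition shift_word :: "nat \<Rightarrow> nat letter list \<Rightarrow> nat letter list" where
  "shift_word n w = map (\<lambda>(i, s). ((i + 1) mod n, s)) w"

definition cyclic_presentation :: "nat \<Rightarrow> nat letter list \<Rightarrow> nat presentation" where
  "cyclic_presentation n w =
     \<lparr> gens = {..<n}, rels = (\<lambda>t. (shift_word n ^^ t) w) ` {..<n} \<rparr>"

definition irreducible_cyclic :: "nat \<Rightarrow> nat letter list \<Rightarrow> bool" where
  "irreducible_cyclic n w \<longleftrightarrow> Gcd (insert n (fst ` set w)) = 1"


section \<open>Star graphs\<close>

definition symmetrized_rels :: "'a presentation \<Rightarrow> 'a letter list set" where
  "symmetrized_rels P = {rotate i r | i r. r \<in> rels P \<union> inv_word ` rels P}"

text \<open>
  An undirected multigraph is represented by a digraph in which each edge occurs as two mutually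
  reverse arcs, together with the arc-reversing involution (the library's \<open>bidirected_digraph\<close>).
  For the star graph, the word \<open>x y\<inverse> u\<close> of the symmetrized relators is itself an arc from \<open>x\<close> to
  \<open>y\<close>, and its reverse is the word \<open>y x\<inverse> u\<inverse>\<close>, an arc from \<open>y\<close> to \<open>x\<close>. So the undirected edges
  of the star graph are the inverse pairs of words, that is, the orbits of \<open>star_rev\<close>. Words of
  length less than 2 are not of the form \<open>x y\<inverse> u\<close> and give no edge.
\<close>

definition star_graph :: "'a presentation \<Rightarrow> ('a letter, 'a letter list) pre_digraph" where
  "star_graph P =
     \<lparr> verts = gens P \<times> UNIV,
       arcs = {r \<in> symmetrized_rels P. 2 \<le> length r},
       tail = (\<lambda>r. r ! 0),
       head = (\<lambda>r. inv_letter (r ! 1)) \<rparr>"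

fun edge_rev :: "'a letter list \<Rightarrow> 'a letter list" where
  "edge_rev (a # b # u) = inv_letter b # inv_letter a # inv_word u"
| "edge_rev r = r"

text \<open>The locale \<open>bidirected_digraph\<close> wants the reversal to be the identity off the arcs.\<close>

definition star_rev :: "'a presentation \<Rightarrow> 'a letter list \<Rightarrow> 'a letter list" where
  "star_rev P r = (if r \<in> arcs (star_graph P) then edge_rev r else r)"

lemma inv_letter_inv_letter [simp]: "inv_letter (inv_letter l) = l"
  by (simp add: inv_letter_def)

lemma inv_word_inv_word [simp]: "inv_word (inv_word w) = w"
  by (simp add: inv_word_def rev_map comp_def)

lemma length_inv_word [simp]: "length (inv_word w) = length w"
  by (simp add: inv_word_def)

lemma length_edge_rev [simp]: "length (edge_rev r) = length r"
  by (cases r rule: edge_rev.cases) auto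

lemma edge_rev_edge_rev [simp]: "edge_rev (edge_rev r) = r"
  by (cases r rule: edge_rev.cases) auto

lemma edge_rev_conv_rotate:
  assumes "2 \<le> length r"
  shows "edge_rev r = rotate (length r - 2) (inv_word r)"
proof -
  obtain a b u where r: "r = a # b # u"
    using assms by (cases r rule: edge_rev.cases) auto
  have "rotate (length (inv_word u)) (inv_word u @ [inv_letter b, inv_letter a])
      = [inv_letter b, inv_letter a] @ inv_word u"
    by (rule rotate_append)
  then show ?thesis
    by (simp add: r inv_word_def)
qed

lemma inv_word_rotate: "\<exists>j. inv_word (rotate i r) = rotate j (inv_word r)"
proof -
  let ?m = "map inv_letter r"
  let ?j = "length r - i mod length r"
  have "rotate (length r - ?j mod length r) ?m = rotate i ?m"
  proof (cases "r = [] \<or> i mod length r = 0")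
    case True
    then show ?thesis
      by (metis (no_types, lifting) length_map list.simps(8) mod_self minus_nat.diff_0
          rotate_conv_mod rotate_is_Nil_conv)
  next
    case False
    then have "?j mod length r = ?j" "length r - ?j = i mod length r"
      by (auto intro!: mod_less diff_less)
    then show ?thesis
      by (metis length_map rotate_conv_mod)
  qed
  then have "inv_word (rotate i r) = rotate ?j (inv_word r)"
    by (simp add: inv_word_def rotate_map rotate_rev)
  then show ?thesis ..
qed

lemma symmetrized_rels_inv_word:
  assumes "r \<in> symmetrized_rels P"
  shows "inv_word r \<in> symmetrized_rels P"
proof -
  obtain i s where s: "r = rotate i s" "s \<in> rels P \<union> inv_word ` rels P"
    using assms by (auto simp: symmetrized_rels_def)
  moreover obtain j where "inv_word (rotate i s) = rotate j (inv_word s)"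
    using inv_word_rotate by blast
  moreover have "inv_word s \<in> rels P \<union> inv_word ` rels P"
    using s(2) by auto
  ultimately show ?thesis
    unfolding symmetrized_rels_def by blast
qed

lemma edge_rev_in_arcs:
  assumes "r \<in> arcs (star_graph P)"
  shows "edge_rev r \<in> arcs (star_graph P)"
proof -
  have r: "r \<in> symmetrized_rels P" "2 \<le> length r"
    using assms by (auto simp: star_graph_def)
  obtain i s where s: "inv_word r = rotate i s" "s \<in> rels P \<union> inv_word ` rels P"
    using symmetrized_rels_inv_word[OF r(1)] by (auto simp: symmetrized_rels_def)
  have "edge_rev r = rotate (length r - 2 + i) s"
    by (simp add: edge_rev_conv_rotate r(2) s(1) rotate_rotate)
  then have "edge_rev r \<in> symmetrized_rels P"
    using s(2) unfolding symmetrized_rels_def by blast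
  then show ?thesis
    using r(2) by (simp add: star_graph_def)
qed

lemma reduced_inv_word: "reduced (inv_word w)" if "reduced w"
  unfolding reduced_def
proof (intro allI impI)
  fix i assume i: "Suc i < length (inv_word w)"
  let ?k = "length w - Suc (Suc i)"
  have "w ! Suc ?k \<noteq> inv_letter (w ! ?k)"
    using that i by (simp add: reduced_def)
  moreover have "Suc ?k = length w - Suc i"
    using i by simp
  ultimately show "inv_word w ! Suc i \<noteq> inv_letter (inv_word w ! i)"
    using i by (auto simp: inv_word_def rev_nth)
qed

lemma symmetrized_rels_letters:
  assumes "finite_presentation P" "r \<in> symmetrized_rels P"
  shows "reduced r" "fst ` set r \<subseteq> gens P"
proof -
  obtain i s where s: "r = rotate i s" "s \<in> rels P \<union> inv_word ` rels P"
    using assms(2) by (auto simp: symmetrized_rels_def)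
  have *: "cyclically_reduced t" "fst ` set t \<subseteq> gens P" if "t \<in> rels P" for t
    using assms(1) that by (auto simp: finite_presentation_def)
  show "fst ` set r \<subseteq> gens P"
    using s * by (fastforce simp: inv_word_def inv_letter_def)
  show "reduced r"
  proof (cases "s \<in> rels P")
    case True
    then show ?thesis
      using * s(1) by (simp add: cyclically_reduced_def)
  next
    case False
    then have "inv_word s \<in> rels P"
      using s(2) by auto
    moreover obtain j where "inv_word r = rotate j (inv_word s)"
      using inv_word_rotate s(1) by blast
    ultimately have "reduced (inv_word r)"
      using * by (simp add: cyclically_reduced_def)
    then show ?thesis
      using reduced_inv_word by fastforce
  qed
qed

lemma bidirected_digraph_star_graph:
  assumes "finite_presentation P"
  shows "bidirected_digraph (star_graph P) (star_rev P)"
proof -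
  let ?G = "star_graph P"
  have arc: "\<exists>a b u. r = a # b # u \<and> b \<noteq> inv_letter a \<and> fst a \<in> gens P \<and> fst b \<in> gens P"
    if r: "r \<in> arcs ?G" for r
  proof -
    have r': "r \<in> symmetrized_rels P" "2 \<le> length r"
      using r by (auto simp: star_graph_def)
    then obtain a b u where "r = a # b # u"
      by (cases r rule: edge_rev.cases) auto
    then show ?thesis
      using symmetrized_rels_letters[OF assms r'(1)] by (force simp: reduced_def)
  qed
  interpret wf_digraph ?G
    by unfold_locales (use arc in \<open>force simp: star_graph_def inv_letter_def\<close>)+
  show ?thesis
  proof (rule bidirected_digraphI)
    fix r assume r: "r \<in> arcs ?G"
    then obtain a b u where "r = a # b # u" "b \<noteq> inv_letter a"
      using arc by blast
    with r edge_rev_in_arcs[OF r] show "star_rev P r \<noteq> r" "star_rev P (star_rev P r) = r"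
      "tail ?G (star_rev P r) = head ?G r"
      by (auto simp: star_rev_def) (auto simp: star_graph_def)
  qed (simp add: star_rev_def)
qed

lemma star_graph_no_loops:
  assumes "finite_presentation P" "r \<in> arcs (star_graph P)"
  shows "tail (star_graph P) r \<noteq> head (star_graph P) r"
proof -
  have r: "r \<in> symmetrized_rels P" "2 \<le> length r"
    using assms by (auto simp: star_graph_def)
  have "r ! 1 \<noteq> inv_letter (r ! 0)"
    using symmetrized_rels_letters(1)[OF assms(1) r(1)] r(2) by (simp add: reduced_def)
  then show ?thesis
    by (auto simp: star_graph_def)
qed


section \<open>Diameter, girth, bipartiteness\<close>

definition diameter :: "('v, 'e) pre_digraph \<Rightarrow> ereal" where
  "diameter G = (SUP u \<in> verts G. SUP v \<in> verts G. wf_digraph.\<mu> G (\<lambda>_. 1) u v)"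

text \<open>Closed paths in which consecutive edges are never equal; equality is that of undirected
  edges, so an arc may be followed neither by itself nor by its reverse.\<close>

definition closed_reduced_path ::
    "('v, 'e) pre_digraph \<Rightarrow> ('e \<Rightarrow> 'e) \<Rightarrow> 'e awalk \<Rightarrow> bool" where
  "closed_reduced_path G rv p \<longleftrightarrow> p \<noteq> [] \<and> (\<exists>u. pre_digraph.awalk G u p u) \<and>
     (\<forall>i. Suc i < length p \<longrightarrow> p ! Suc i \<noteq> p ! i \<and> p ! Suc i \<noteq> rv (p ! i))"

definition girth :: "('v, 'e) pre_digraph \<Rightarrow> ('e \<Rightarrow> 'e) \<Rightarrow> enat" where
  "girth G rv = (INF p \<in> {p. closed_reduced_path G rv p}. enat (length p))"

definition bipartite :: "('v, 'e) pre_digraph \<Rightarrow> bool" where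
  "bipartite G \<longleftrightarrow> (\<exists>A B. A \<union> B = verts G \<and> A \<inter> B = {} \<and>
     (\<forall>e \<in> arcs G. tail G e \<in> A \<and> head G e \<in> B \<or> tail G e \<in> B \<and> head G e \<in> A))"


section \<open>Special presentations\<close>

text \<open>
  In a bidirected digraph the strongly connected components are the connected components of the
  underlying undirected graph. The out-degree of a vertex is its undirected degree, and since
  there are no loops (\<open>star_graph_no_loops\<close>), digraph isomorphism is isomorphism of the
  undirected multigraphs.
\<close>

definition special_presentation :: "nat \<Rightarrow> nat \<Rightarrow> nat \<Rightarrow> 'a presentation \<Rightarrow> bool" where
  "special_presentation m k \<nu> P \<longleftrightarrow>
     2 \<le> m \<and> 3 \<le> k \<and> 1 \<le> \<nu> \<and> finite_presentation P \<and>
     (let components = pre_digraph.sccs (star_graph P) in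
        card components = \<nu> \<and>
        (\<forall>C \<in> components. \<forall>D \<in> components. digraph_iso C D) \<and>
        (\<forall>C \<in> components.
           bipartite C \<and> diameter C = ereal (real m) \<and> girth C (star_rev P) = enat (2 * m) \<and>
           (\<forall>v \<in> verts C. 3 \<le> out_degree C v))) \<and>
     (\<forall>r \<in> rels P. length r = k) \<and>
     (m = 2 \<longrightarrow> 4 \<le> k)"

end

theory Submission
  imports Defs "HOL-Number_Theory.Cong"
begin

text \<open>
  Write \<open>a = q1\<close>, \<open>b = q2\<close>, \<open>c = - a - b\<close>. The star graph has the vertices \<open>x\<^sub>i\<close> and their inverses, and
  \<open>x\<^sub>i\<close> is adjacent to the inverse of \<open>x\<^sub>j\<close> exactly when \<open>j - i\<close> is \<open>a\<close>, \<open>b\<close> or \<open>c\<close> modulo \<open>n\<close>.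
  Girth 6 says that \<open>{a, b, c}\<close> is a Sidon set with three elements, so that it has seven differences;
  diameter 3 says that these differences are closed under addition. Summing over this group of order 7
  gives \<open>7 (a - b) = 7 (a - c) = 0\<close>, hence \<open>21 a = 0\<close> because \<open>a + b + c = 0\<close>, and likewise for \<open>b\<close>;
  irreducibility then yields \<open>n dvd 21\<close>, and the finitely many remaining triples are inspected.
  Conversely, if the differences of a Sidon triple are the multiples of \<open>h\<close>, where the triple is
  constant modulo \<open>h\<close>, then the star graph has \<open>h\<close> components, which are translates of each other.
\<close>

section \<open>Walks, diameter and girth\<close>

context wf_digraph
begin

lemma awalk_cost_length: "awalk_cost (\<lambda>_. 1) p = real (length p)"
  by (simp add: awalk_cost_def sum_list_triv)

text \<open>The diameter is a double supremum of distances: short walks bound it from above, and the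
  single pair \<open>u0\<close>, \<open>v0\<close> witnesses the lower bound.\<close>

lemma diameter_eqI:
  assumes "\<And>u v. u \<in> verts G \<Longrightarrow> v \<in> verts G \<Longrightarrow> \<exists>p. awalk u p v \<and> length p \<le> m"
    and "u0 \<in> verts G" "v0 \<in> verts G" "\<And>p. awalk u0 p v0 \<Longrightarrow> m \<le> length p"
  shows "diameter G = ereal (real m)"
proof (rule antisym)
  have "\<mu> (\<lambda>_. 1) u v \<le> ereal (real m)" if uv: "u \<in> verts G" "v \<in> verts G" for u v
  proof -
    obtain p where "awalk u p v" "length p \<le> m"
      using assms(1) uv by blast
    then show ?thesis
      unfolding \<mu>_def by (intro INF_lower2[of p]) (auto simp: awalk_cost_length)
  qed
  then show "diameter G \<le> ereal (real m)"
    by (auto simp: diameter_def intro!: SUP_least)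
  have "ereal (real m) \<le> \<mu> (\<lambda>_. 1) u0 v0"
    using assms(4) by (auto simp: \<mu>_def awalk_cost_length intro!: INF_greatest)
  also have "\<dots> \<le> diameter G"
    unfolding diameter_def using assms(2,3) by (intro SUP_upper2[of u0] SUP_upper2[of v0]) auto
  finally show "ereal (real m) \<le> diameter G" .
qed

lemma short_awalk_if_diameter:
  assumes "diameter G \<le> ereal (real m)" "u \<in> verts G" "v \<in> verts G"
  shows "\<exists>p. awalk u p v \<and> length p \<le> m"
proof -
  have "\<mu> (\<lambda>_. 1) u v \<le> diameter G"
    unfolding diameter_def using assms(2,3) by (intro SUP_upper2[of u] SUP_upper2[of v]) auto
  \<comment> \<open>The strict inequality turns the infimum over walks into an actual walk of length
    below \<open>m + 1\<close>, hence at most \<open>m\<close>.\<close>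
  also have "\<dots> < ereal (real m + 1)"
    using assms(1) by (simp add: le_less_trans)
  finally show ?thesis
    by (auto simp: \<mu>_def awalk_cost_length INF_less_iff)
qed

lemma awalk_invariant:
  assumes "\<And>e. e \<in> arcs G \<Longrightarrow> f (tail G e) = f (head G e)" "awalk u p v"
  shows "f u = f v"
  using assms(2) by (induction p arbitrary: u) (auto simp: awalk_Nil_iff awalk_Cons_iff assms(1))

text \<open>A walk never leaves the fibre of \<open>f\<close> in which it starts, so walks of the
  whole graph and of the induced subgraph agree.\<close>

lemma awalk_induce_invariant:
  assumes "\<And>e. e \<in> arcs G \<Longrightarrow> f (tail G e) = f (head G e)" "f u = r"
  shows "pre_digraph.awalk (G \<restriction> {v \<in> verts G. f v = r}) u p v \<longleftrightarrow> awalk u p v"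
proof -
  interpret C: wf_digraph "G \<restriction> {v \<in> verts G. f v = r}"
    by (rule wellformed_induce_subgraph)
  show ?thesis
    using assms(2)
    by (induction p arbitrary: u)
      (auto simp: awalk_Nil_iff awalk_Cons_iff C.awalk_Nil_iff C.awalk_Cons_iff assms(1))
qed

lemma scc_of_invariant:
  assumes "\<And>e. e \<in> arcs G \<Longrightarrow> f (tail G e) = f (head G e)"
    and "\<And>u v. u \<in> verts G \<Longrightarrow> v \<in> verts G \<Longrightarrow> f u = f v \<Longrightarrow> u \<rightarrow>\<^sup>* v" and "u \<in> verts G"
  shows "scc_of u = {v \<in> verts G. f v = f u}"
proof -
  have "f v = f u" if "u \<rightarrow>\<^sup>* v" for v
    using that awalk_invariant[of f, OF assms(1)] by (auto simp: reachable_awalk)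
  moreover have "v \<rightarrow>\<^sup>* u" "u \<rightarrow>\<^sup>* v" if "v \<in> verts G" "f v = f u" for v
    using that assms(2)[of u v] assms(2)[of v u] assms(3) by simp_all
  moreover have "v \<in> verts G" if "u \<rightarrow>\<^sup>* v" for v
    using that by (rule reachable_in_verts)
  ultimately show ?thesis
    unfolding scc_of_def by blast
qed

text \<open>An invariant of arcs whose fibres are connected has exactly the components as its
  fibres, so its values count them. It is applied to an explicit residue and to
  \<open>scc_of\<close> itself.\<close>

lemma sccs_invariant:
  assumes "\<And>e. e \<in> arcs G \<Longrightarrow> f (tail G e) = f (head G e)"
    and "\<And>u v. u \<in> verts G \<Longrightarrow> v \<in> verts G \<Longrightarrow> f u = f v \<Longrightarrow> u \<rightarrow>\<^sup>* v"
  shows "sccs = (\<lambda>r. G \<restriction> {v \<in> verts G. f v = r}) ` f ` verts G"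
    "card sccs = card (f ` verts G)"
proof -
  have eq: "sccs_verts = (\<lambda>r. {v \<in> verts G. f v = r}) ` f ` verts G"
    unfolding sccs_verts_conv_scc_of image_image by (rule image_cong) (auto simp: scc_of_invariant[OF assms])
  then show "sccs = (\<lambda>r. G \<restriction> {v \<in> verts G. f v = r}) ` f ` verts G"
    by (simp add: sccs_conv_sccs_verts image_image)
  have "inj_on (\<lambda>r. {v \<in> verts G. f v = r}) (f ` verts G)"
    by (rule inj_onI) blast
  then show "card sccs = card (f ` verts G)"
    by (simp flip: card_sccs_verts add: eq card_image)
qed

end

lemma girth_eqI:
  assumes "closed_reduced_path G rv p" "length p = g"
    and "\<And>q. closed_reduced_path G rv q \<Longrightarrow> g \<le> length q"
  shows "girth G rv = enat g"
  unfolding girth_def using assms by (intro antisym INF_lower2[of p] INF_greatest) auto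

lemma girth_le: "closed_reduced_path G rv p \<Longrightarrow> girth G rv \<le> enat (length p)"
  unfolding girth_def by (rule INF_lower) simp

section \<open>Components as fibres of \<open>scc_of\<close>\<close>

context bidirected_digraph
begin

lemma scc_of_arc:
  assumes "e \<in> arcs G"
  shows "scc_of (tail G e) = scc_of (head G e)"
proof -
  have "tail G e \<rightarrow>\<^sup>*\<^bsub>G\<^esub> head G e"
    using assms by (rule reachable_awalkI[OF arc_implies_awalk])
  moreover have "head G e \<rightarrow>\<^sup>*\<^bsub>G\<^esub> tail G e"
    using reachable_awalkI[OF arc_implies_awalk[OF arev_in_arcs[OF assms]]] assms by simp
  ultimately show ?thesis
    by (auto simp: scc_of_def intro: reachable_trans)
qed

lemma reachable_if_scc_of_eq: "v \<in> verts G \<Longrightarrow> scc_of u = scc_of v \<Longrightarrow> u \<rightarrow>\<^sup>*\<^bsub>G\<^esub> v"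
  using in_scc_of_self[of v] by (auto simp: scc_of_def)

abbreviation component_of :: "'a \<Rightarrow> ('a, 'b) pre_digraph" where
  "component_of u \<equiv> G \<restriction> {v \<in> verts G. scc_of v = scc_of u}"

lemma component_of_in_sccs:
  assumes "u \<in> verts G"
  shows "component_of u \<in> sccs"
proof -
  have "sccs = (\<lambda>r. G \<restriction> {v \<in> verts G. scc_of v = r}) ` scc_of ` verts G"
    by (rule sccs_invariant(1)) (use scc_of_arc reachable_if_scc_of_eq in auto)
  then show ?thesis
    using assms by blast
qed

lemma awalk_component_of: "pre_digraph.awalk (component_of u) u p v \<longleftrightarrow> awalk u p v"
  using awalk_induce_invariant[of scc_of u] scc_of_arc by blast

end

section \<open>Residues modulo 7 and 21\<close>

lemma atLeastLessThan_21: "{0..<21::int} = {0,1,2,3,4,5,6,7,8,9,10,11,12,13,14,15,16,17,18,19,20}"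
proof -
  have "{0..<21::int} = set [0..20]"
    by auto
  also have "[0..20] = [0,1,2,3,4,5,6,7,8,9,10,11,12,13,14,15,16,17,18,19,20::int]"
    by (simp add: upto_rec1)
  finally show ?thesis by simp
qed

lemma atLeastLessThan_7: "{0..<7::int} = {0,1,2,3,4,5,6}"
proof -
  have "{0..<7::int} = set [0..6]"
    by auto
  also have "[0..6] = [0,1,2,3,4,5,6::int]"
    by (simp add: upto_rec1)
  finally show ?thesis by simp
qed

text \<open>The sum is a multiple of \<open>m\<close> strictly between 0 and \<open>3 * m\<close>.
  This lets \<open>c\<close> be eliminated as \<open>s - a - b\<close> with two candidates for
  \<open>s\<close>, without any \<open>mod\<close> in the enumerations.\<close>

lemma residue_sum:
  fixes a b c m :: int
  assumes "0 < a" "a < m" "0 < b" "b < m" "0 < c" "c < m" "c = (- a - b) mod m"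
  shows "a + b + c \<in> {m, 2 * m}"
proof -
  have "(a + b + c) mod m = 0"
    unfolding assms(7) by (simp add: mod_add_right_eq)
  then obtain k where k: "a + b + c = m * k"
    by (auto simp: mod_eq_0_iff_dvd)
  then have "m * 0 < m * k" "m * k < m * 3"
    using assms by linarith+
  then have "0 < k" "k < 3"
    using assms by (simp_all only: mult_less_cancel_left_pos)
  then have "k = 1 \<or> k = 2"
    by linarith
  then show ?thesis
    using k by auto
qed

lemma residues_7:
  fixes a b c m :: int
  assumes m: "m = 7" and "a \<in> {0..<m}" "b \<in> {0..<m}" and c: "c = (- a - b) mod m"
    and "a \<noteq> b" "a \<noteq> c" "b \<noteq> c" and "3 * a mod m \<noteq> 0" "3 * b mod m \<noteq> 0" "3 * c mod m \<noteq> 0"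
  shows "{a, b, c} \<in> {{1, 2, 4}, {3, 5, 6}}"
proof -
  have "\<forall>x\<in>{0..<7::int}. 3 * x mod 7 \<noteq> 0 \<longrightarrow> x \<in> {1, 2, 3, 4, 5, 6}"
    unfolding atLeastLessThan_7 by simp
  note units = this[folded m, rule_format]
  have c_range: "c \<in> {0..<m}"
    by (simp add: c m)
  have S: "a \<in> {1, 2, 3, 4, 5, 6}" "b \<in> {1, 2, 3, 4, 5, 6}" "c \<in> {1, 2, 3, 4, 5, 6}"
    by (rule units[OF assms(2,8)] units[OF assms(3,9)] units[OF c_range assms(10)])+
  have "0 < a" "0 < b" "0 < c"
    using assms(2,3,8-10) c_range by (auto simp: less_le)
  then have "a + b + c \<in> {m, 2 * m}"
    using assms(2,3) c_range c by (intro residue_sum) simp_all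
  then have s: "a + b + c \<in> {7, 14}"
    by (simp add: m)
  have "\<forall>a\<in>{1, 2, 3, 4, 5, 6}. \<forall>b\<in>{1, 2, 3, 4, 5, 6}. \<forall>s\<in>{7, 14}.
    s - a - b \<in> {1, 2, 3, 4, 5, 6} \<longrightarrow> a \<noteq> b \<longrightarrow> a \<noteq> s - a - b \<longrightarrow> b \<noteq> s - a - b \<longrightarrow>
    {a, b, s - a - b} \<in> {{1, 2, 4}, {3, 5, 6 :: int}}"
    by (simp add: insert_commute)
  note triples = this[rule_format, OF S(1,2) s]
  have "a + b + c - a - b = c"
    by simp
  from triples[unfolded this, OF S(3) assms(5-7)] show ?thesis .
qed

text \<open>From \<open>7 * (a - b) mod m = 0\<close> follows \<open>b mod 3 = a mod 3\<close>, and
  then the zero sum modulo 21 puts \<open>c\<close> into the same class. The class of 0 is excluded,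
  and the conditions on \<open>3 * x\<close> exclude the multiples of 7, so each of the two other
  classes leaves six candidates.\<close>

lemma residues_21:
  fixes a b c m :: int
  assumes m: "m = 21" and "a \<in> {0..<m}" "b \<in> {0..<m}" and c: "c = (- a - b) mod m"
    and "a \<noteq> b" "a \<noteq> c" "b \<noteq> c" and "3 * a mod m \<noteq> 0" "3 * b mod m \<noteq> 0" "3 * c mod m \<noteq> 0"
    and "7 * (a - b) mod m = 0" "\<not> 3 dvd a"
  shows "{a, b, c} \<in> {{1, 4, 16}, {2, 8, 11}, {5, 17, 20}, {10, 13, 19}}"
proof -
  let ?S1 = "{1, 4, 10, 13, 16, 19 :: int}" and ?S2 = "{2, 5, 8, 11, 17, 20 :: int}"
  have "\<forall>x\<in>{0..<21::int}. 3 * x mod 21 \<noteq> 0 \<longrightarrow> x mod 3 = 1 \<longrightarrow> x \<in> ?S1"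
    unfolding atLeastLessThan_21 by simp
  note units1 = this[folded m, rule_format]
  have "\<forall>x\<in>{0..<21::int}. 3 * x mod 21 \<noteq> 0 \<longrightarrow> x mod 3 = 2 \<longrightarrow> x \<in> ?S2"
    unfolding atLeastLessThan_21 by simp
  note units2 = this[folded m, rule_format]
  have c_range: "c \<in> {0..<m}"
    by (simp add: c m)
  have nonzero: "0 < a" "0 < b" "0 < c"
    using assms(2,3,8-10) c_range by (auto simp: less_le)
  then have "a + b + c \<in> {m, 2 * m}"
    using assms(2,3) c_range c by (intro residue_sum) simp_all
  then have s: "a + b + c \<in> {21, 42}"
    by (simp add: m)
  have "7 * 3 dvd 7 * (a - b)"
    using assms(11) by (simp add: m mod_eq_0_iff_dvd)
  then have "3 dvd a - b"
    unfolding dvd_mult_cancel_left by simp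
  then have "b mod 3 = a mod 3"
    by presburger
  have "c mod 3 = (- a - b) mod 3"
    by (simp add: c m mod_mod_cancel)
  also have "\<dots> = a mod 3"
    using \<open>3 dvd a - b\<close> by presburger
  finally have mod_3: "b mod 3 = a mod 3" "c mod 3 = a mod 3"
    using \<open>b mod 3 = a mod 3\<close> by simp_all
  have c_eq: "a + b + c - a - b = c"
    by simp
  from assms(12) have "a mod 3 = 1 \<or> a mod 3 = 2"
    by presburger
  then show ?thesis
  proof
    assume *: "a mod 3 = 1"
    then have "b mod 3 = 1" "c mod 3 = 1"
      by (simp_all only: mod_3)
    with * have S: "a \<in> ?S1" "b \<in> ?S1" "c \<in> ?S1"
      by (simp_all only: units1[OF assms(2,8)] units1[OF assms(3,9)] units1[OF c_range assms(10)])
    have "\<forall>a\<in>?S1. \<forall>b\<in>?S1. \<forall>s\<in>{21, 42}.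
      s - a - b \<in> ?S1 \<longrightarrow> a \<noteq> b \<longrightarrow> a \<noteq> s - a - b \<longrightarrow> b \<noteq> s - a - b \<longrightarrow>
      {a, b, s - a - b} \<in> {{1, 4, 16}, {10, 13, 19}}"
      by (simp add: insert_commute)
    from this[rule_format, OF S(1,2) s, unfolded c_eq, OF S(3) assms(5-7)] show ?thesis
      by (rule subsetD[rotated]) simp
  next
    assume *: "a mod 3 = 2"
    then have "b mod 3 = 2" "c mod 3 = 2"
      by (simp_all only: mod_3)
    with * have S: "a \<in> ?S2" "b \<in> ?S2" "c \<in> ?S2"
      by (simp_all only: units2[OF assms(2,8)] units2[OF assms(3,9)] units2[OF c_range assms(10)])
    have "\<forall>a\<in>?S2. \<forall>b\<in>?S2. \<forall>s\<in>{21, 42}.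
      s - a - b \<in> ?S2 \<longrightarrow> a \<noteq> b \<longrightarrow> a \<noteq> s - a - b \<longrightarrow> b \<noteq> s - a - b \<longrightarrow>
      {a, b, s - a - b} \<in> {{2, 8, 11}, {5, 17, 20}}"
      by (simp add: insert_commute)
    from this[rule_format, OF S(1,2) s, unfolded c_eq, OF S(3) assms(5-7)] show ?thesis
      by (rule subsetD[rotated]) simp
  qed
qed

text \<open>Up to reduction modulo \<open>n\<close>, these are for \<open>n = 7\<close>,
  \<open>h = 1\<close> the planar difference sets of the Fano plane, and for \<open>n = 21\<close>,
  \<open>h = 3\<close> translates of such sets in the subgroup of order 7. All quantifiers range
  over finite sets, so rewriting decides explicit instances.\<close>

definition perfect_residues :: "nat \<Rightarrow> nat \<Rightarrow> int set \<Rightarrow> bool" where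
  "perfect_residues n h E \<longleftrightarrow> card E = 3 \<and>
     (\<forall>d\<in>E. \<forall>e\<in>E. d mod int h = e mod int h) \<and>
     (\<forall>a\<in>E. \<forall>b\<in>E. \<forall>c\<in>E. \<forall>d\<in>E. (a + b) mod int n = (c + d) mod int n \<longrightarrow> a = c \<or> a = d) \<and>
     (\<forall>x\<in>{0..<int n}. x mod int h = 0 \<longrightarrow> (\<exists>d\<in>E. \<exists>e\<in>E. x = (d - e) mod int n))"

lemma perfect_residues_7: "\<forall>E\<in>{{1, 2, 4}, {3, 5, 6}}. perfect_residues 7 1 E"
  by (simp add: perfect_residues_def atLeastLessThan_7)

lemma perfect_residues_21:
  "\<forall>E\<in>{{1, 4, 16}, {2, 8, 11}, {5, 17, 20}, {10, 13, 19}}. perfect_residues 21 3 E"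
  by (simp add: perfect_residues_def atLeastLessThan_21)

lemma perfect_residuesD:
  assumes "perfect_residues n h E"
  shows "card E = 3"
    and "d \<in> E \<Longrightarrow> e \<in> E \<Longrightarrow> d mod int h = e mod int h"
    and "a \<in> E \<Longrightarrow> b \<in> E \<Longrightarrow> c \<in> E \<Longrightarrow> d \<in> E \<Longrightarrow>
      (a + b) mod int n = (c + d) mod int n \<Longrightarrow> a = c \<or> a = d"
    and "x \<in> {0..<int n} \<Longrightarrow> x mod int h = 0 \<Longrightarrow> \<exists>d\<in>E. \<exists>e\<in>E. x = (d - e) mod int n"
proof -
  note perfect = assms[unfolded perfect_residues_def]
  show "card E = 3"
    using perfect by (rule conjunct1)
  show "d \<in> E \<Longrightarrow> e \<in> E \<Longrightarrow> d mod int h = e mod int h"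
    and "a \<in> E \<Longrightarrow> b \<in> E \<Longrightarrow> c \<in> E \<Longrightarrow> d \<in> E \<Longrightarrow>
      (a + b) mod int n = (c + d) mod int n \<Longrightarrow> a = c \<or> a = d"
    using perfect by blast+
  show "x \<in> {0..<int n} \<Longrightarrow> x mod int h = 0 \<Longrightarrow> \<exists>d\<in>E. \<exists>e\<in>E. x = (d - e) mod int n"
    using perfect[THEN conjunct2, THEN conjunct2, THEN conjunct2, rule_format] .
qed

section \<open>The star graph of a cyclic presentation with relators of length 3\<close>

locale cyclic_triple =
  fixes n q1 q2 :: nat
  assumes q1_less: "q1 < n"
begin

lemma n_pos: "0 < n"
  using q1_less by simp

text \<open>Not reduced modulo \<open>n\<close>: the three increments sum to exactly 0, so running
  once around a relator returns to the same integer.\<close>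

definition q3 :: int where "q3 = - int q1 - int q2"
definition D :: "int set" where "D = {int q1, int q2, q3}"
text \<open>The cyclically consecutive pairs of increments; with a starting subscript, such a pair
  fixes a cyclic permutation of a relator.\<close>

definition steps :: "(int \<times> int) set" where "steps = {(int q1, int q2), (int q2, q3), (q3, int q1)}"
definition V :: "bool \<Rightarrow> int \<Rightarrow> nat letter" where "V s x = (nat (x mod int n), s)"

abbreviation w :: "nat letter list" where
  "w \<equiv> [(0, True), (q1, True), ((q1 + q2) mod n, True)]"
abbreviation P :: "nat presentation" where "P \<equiv> cyclic_presentation n w"
abbreviation G :: "(nat letter, nat letter list) pre_digraph" where "G \<equiv> star_graph P"
abbreviation eqm :: "int \<Rightarrow> int \<Rightarrow> bool" (infix "\<simeq>" 50) where "x \<simeq> y \<equiv> [x = y] (mod int n)"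

text \<open>\<open>W True x d e\<close> is a cyclic permutation of a relator, started at the generator \<open>x\<close>; \<open>W False x d e\<close> is
  one of an inverse relator.\<close>

definition W :: "bool \<Rightarrow> int \<Rightarrow> int \<Rightarrow> int \<Rightarrow> nat letter list" where
  "W s x d e = (if s then [V s x, V s (x + d), V s (x + d + e)] else [V s x, V s (x - e), V s (x - e - d)])"

lemma V_eq_iff: "V s x = V t y \<longleftrightarrow> s = t \<and> x \<simeq> y"
  using n_pos by (auto simp: V_def cong_def nat_eq_iff)

lemma inv_letter_V: "inv_letter (V s x) = V (\<not> s) x"
  by (simp add: V_def inv_letter_def)

lemma verts_G: "verts G = range (case_prod V)"
proof (intro equalityI subsetI)
  fix v assume "v \<in> verts G"
  then have "fst v < n"
    by (auto simp: star_graph_def cyclic_presentation_def)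
  then have "v = V (snd v) (int (fst v))"
    by (simp add: V_def)
  then show "v \<in> range (case_prod V)"
    by (metis case_prod_conv rangeI)
qed (use n_pos in \<open>auto simp: star_graph_def cyclic_presentation_def V_def nat_less_iff\<close>)

lemma V_in_verts [simp]: "V s x \<in> verts G"
  by (auto simp: verts_G)

lemma vertsE:
  assumes "v \<in> verts G"
  obtains s x where "v = V s x"
  using assms by (auto simp: verts_G)

lemma shift_word_W: "shift_word n (W True x d e) = W True (x + 1) d e"
proof -
  have "V True (x + 1) = (\<lambda>(i, s). ((i + 1) mod n, s)) (V True x)" for x
  proof -
    have "int ((nat (x mod int n) + 1) mod n) = (x + 1) mod int n"
      using n_pos by (simp add: zmod_int mod_simps add.commute)
    then show ?thesis
      by (simp add: V_def)
  qed
  from this[of x] this[of "x + d"] this[of "x + d + e"] show ?thesis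
    by (simp add: W_def shift_word_def algebra_simps)
qed

lemma funpow_shift_word: "(shift_word n ^^ t) w = W True (int t) (int q1) (int q2)"
proof (induction t)
  case 0
  then show ?case
    using q1_less by (simp add: W_def V_def nat_mod_distrib flip: of_nat_add)
next
  case (Suc t)
  then show ?case
    by (simp add: shift_word_W add.commute)
qed

lemma W_cong: "x \<simeq> y \<Longrightarrow> W s x d e = W s y d e"
  by (simp add: W_def V_eq_iff cong_add cong_diff)

lemma rels_P: "rels P = range (\<lambda>x. W True x (int q1) (int q2))"
proof -
  have "W True x (int q1) (int q2) \<in> (\<lambda>t. (shift_word n ^^ t) w) ` {..<n}" for x
  proof (rule image_eqI)
    show "nat (x mod int n) \<in> {..<n}"
      using n_pos by (simp add: nat_less_iff)
    show "W True x (int q1) (int q2) = (shift_word n ^^ nat (x mod int n)) w"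
      unfolding funpow_shift_word using n_pos by (intro W_cong) (simp add: cong_def)
  qed
  then show ?thesis
    by (auto simp: cyclic_presentation_def funpow_shift_word)
qed

section \<open>Rotations and inverses of the relators\<close>

lemma steps_rotate:
  assumes "(d, e) \<in> steps"
  shows "(e, - d - e) \<in> steps" "(- d - e, d) \<in> steps"
  using assms by (auto simp: steps_def q3_def)

text \<open>An inverse relator runs through the increments backwards, so its rotation moves to the
  preceding pair of \<open>steps\<close> instead of the following one.\<close>

lemma rotate1_W:
  "rotate1 (W True x d e) = W True (x + d) e (- d - e)"
  "rotate1 (W False x d e) = W False (x - e) (- d - e) d"
  by (simp_all add: W_def)

lemma rotate_W:
  assumes "(d, e) \<in> steps"
  shows "\<exists>y f g. (f, g) \<in> steps \<and> rotate i (W s x d e) = W s y f g"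
proof (induction i)
  case 0
  then show ?case
    using assms by auto
next
  case (Suc i)
  then obtain y f g where "(f, g) \<in> steps" "rotate i (W s x d e) = W s y f g"
    by blast
  then show ?case
    using steps_rotate by (cases s) (auto simp: rotate1_W, blast+)
qed

lemma inv_word_W: "inv_word (W s x d e) = W (\<not> s) (if s then x + d + e else x - e - d) d e"
  by (simp add: W_def inv_word_def inv_letter_V)

lemma symmetrized_rels_P: "symmetrized_rels P = {W s x d e | s x d e. (d, e) \<in> steps}"
proof (intro equalityI subsetI)
  fix r assume "r \<in> symmetrized_rels P"
  then obtain i s x where "r = rotate i (W s x (int q1) (int q2))"
    by (auto simp: symmetrized_rels_def rels_P inv_word_W)
  moreover have "(int q1, int q2) \<in> steps"
    by (simp add: steps_def)
  ultimately show "r \<in> {W s x d e | s x d e. (d, e) \<in> steps}"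
    using rotate_W by blast
next
  fix r assume "r \<in> {W s x d e | s x d e. (d, e) \<in> steps}"
  then obtain s x d e where r: "r = W s x d e" "(d, e) \<in> steps"
    by blast
  have base: "W s x (int q1) (int q2) \<in> rels P \<union> inv_word ` rels P" for s x
  proof (cases s)
    case False
    then have "W s x (int q1) (int q2) = inv_word (W True (x - int q1 - int q2) (int q1) (int q2))"
      by (simp add: inv_word_W)
    then show ?thesis
      by (auto simp: rels_P)
  qed (auto simp: rels_P)
  have "\<exists>i y. r = rotate i (W s y (int q1) (int q2))"
  proof -
    have rot: "rotate 1 (W True x d e) = W True (x + d) e (- d - e)"
      "rotate 2 (W True x d e) = W True (x + d + e) (- d - e) d"
      "rotate 1 (W False x d e) = W False (x - e) (- d - e) d"
      "rotate 2 (W False x d e) = W False (x - e - d) e (- d - e)" for x d e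
      by (simp_all add: rotate1_W numeral_2_eq_2)
    from r(2) consider "d = int q1" "e = int q2" | "d = int q2" "e = q3" | "d = q3" "e = int q1"
      by (auto simp: steps_def)
    then show ?thesis
    proof cases
      case 1
      then show ?thesis
        using r by (metis rotate0 id_apply)
    next
      case 2
      \<comment> \<open>Inverse words meet the increments in the opposite order, so the rotation
        numbers 1 and 2 trade places with the sign. The chosen subscript undoes the displacement
        caused by the rotation.\<close>
      then have "r = rotate (if s then 1 else 2)
          (W s (if s then x - int q1 else x + int q2 + int q1) (int q1) (int q2))"
        by (simp add: r(1) rot q3_def del: One_nat_def)
      then show ?thesis by blast
    next
      case 3
      then have "r = rotate (if s then 2 else 1)
          (W s (if s then x - int q1 - int q2 else x + int q2) (int q1) (int q2))"
        by (simp add: r(1) rot q3_def del: One_nat_def)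
      then show ?thesis by blast
    qed
  qed
  then show "r \<in> symmetrized_rels P"
    using base unfolding symmetrized_rels_def by blast
qed

lemma length_W [simp]: "length (W s x d e) = 3"
  by (simp add: W_def)

lemma arcs_G: "arcs G = {W s x d e | s x d e. (d, e) \<in> steps}"
  by (auto simp: star_graph_def symmetrized_rels_P)

lemma tail_W [simp]: "tail G (W s x d e) = V s x"
  by (simp add: star_graph_def W_def)

lemma head_W [simp]: "head G (W s x d e) = V (\<not> s) (if s then x + d else x - e)"
  by (simp add: star_graph_def W_def inv_letter_V)

text \<open>The relators are positive words, so no rotation has a letter next to its
  inverse.\<close>

lemma finite_presentation_P: "finite_presentation P"
proof -
  have "cyclically_reduced r" "fst ` set r \<subseteq> {..<n}" if "r \<in> rels P" for r
  proof -
    have pos: "snd ` set r \<subseteq> {True}"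
      using that by (auto simp: rels_P W_def V_def)
    have *: "snd (rotate i r ! j)" if "j < length r" for i j
    proof -
      have "rotate i r ! j \<in> set r"
        using that by (metis length_rotate nth_mem set_rotate)
      then show ?thesis
        using pos by auto
    qed
    have "rotate i r ! Suc j \<noteq> inv_letter (rotate i r ! j)" if "Suc j < length r" for i j
      using * [of j i] *[of "Suc j" i] that by (auto simp: inv_letter_def)
    then show "cyclically_reduced r"
      by (simp add: cyclically_reduced_def reduced_def)
    show "fst ` set r \<subseteq> {..<n}"
      using that n_pos by (auto simp: rels_P W_def V_def nat_less_iff)
  qed
  then show ?thesis
    by (auto simp: finite_presentation_def cyclic_presentation_def)
qed

section \<open>Adjacency and walks described by steps\<close>

sublocale bidirected_digraph G "star_rev P"
  by (rule bidirected_digraph_star_graph[OF finite_presentation_P])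

lemma step_D: "(d, e) \<in> steps \<Longrightarrow> d \<in> D \<and> e \<in> D"
  by (auto simp: steps_def D_def)

lemma D_step: "d \<in> D \<Longrightarrow> \<exists>e. (d, e) \<in> steps"  "d \<in> D \<Longrightarrow> \<exists>e. (e, d) \<in> steps"
  by (auto simp: steps_def D_def)

text \<open>An edge adds its step when it leaves a generator and subtracts it when it leaves an
  inverse; the sign covers both sides of the bipartition by one formula.\<close>

definition sg :: "bool \<Rightarrow> int" where "sg s = (if s then 1 else - 1)"

lemma sg_simps [simp]: "sg True = 1" "sg False = - 1" "sg (\<not> s) = - sg s"
  by (simp_all add: sg_def)

lemma sg_mult_cancel: "sg s * d \<simeq> sg s * e \<longleftrightarrow> d \<simeq> e"
  by (cases s) (simp_all add: cong_minus_minus_iff)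

lemma head_W_sg: "head G (W s x d e) = V (\<not> s) (x + sg s * (if s then d else e))"
  by simp

text \<open>Each step is the first entry of one pair in \<open>steps\<close> and the second entry of
  another. The first occurrence gives the arc at a generator, the second the arc at an
  inverse.\<close>

lemma arc_exists:
  assumes "d \<in> D"
  shows "\<exists>e\<in>arcs G. tail G e = V s x \<and> head G e = V (\<not> s) (x + sg s * d)"
proof -
  obtain e f where "(d, e) \<in> steps" "(f, d) \<in> steps"
    using D_step assms by blast
  then have "W True x d e \<in> arcs G" "W False x f d \<in> arcs G"
    by (auto simp: arcs_G)
  then show ?thesis
    by (cases s) force+
qed

lemma arc_head:
  assumes "a \<in> arcs G" "tail G a = V s x"
  shows "\<exists>d\<in>D. head G a = V (\<not> s) (x + sg s * d)"
proof -
  obtain t y d e where a: "a = W t y d e" "(d, e) \<in> steps"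
    using assms by (auto simp: arcs_G)
  then have "s = t" "x \<simeq> y"
    using assms(2) by (auto simp: V_eq_iff cong_sym)
  then have "head G a = V (\<not> s) (x + sg s * (if s then d else e))"
    by (simp add: a(1) head_W_sg V_eq_iff cong_add cong_sym del: head_W)
  then show ?thesis
    using step_D[OF a(2)] by (metis (full_types))
qed

text \<open>Every edge flips the sign of the vertex, so the listed steps are alternately added and
  subtracted.\<close>

primrec path_end :: "bool \<Rightarrow> int \<Rightarrow> int list \<Rightarrow> nat letter" where
  "path_end s x [] = V s x"
| "path_end s x (d # ds) = path_end (\<not> s) (x + sg s * d) ds"

lemma snd_tail_head: "e \<in> arcs G \<Longrightarrow> snd (head G e) \<longleftrightarrow> \<not> snd (tail G e)"
  by (auto simp: arcs_G V_def)

text \<open>An arc cannot follow itself because the signs of its ends differ, and following it by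
  its reverse would return to the previous vertex, which needs equal steps modulo \<open>n\<close>.
  The clause on \<open>hd p\<close> carries the end of the next arc through the induction.\<close>

lemma reduced_awalk_exists:
  assumes "set ds \<subseteq> D" "successively (\<lambda>d e. \<not> d \<simeq> e) ds"
  shows "\<exists>p. awalk (V s x) p (path_end s x ds) \<and> length p = length ds \<and>
    (p \<noteq> [] \<longrightarrow> head G (hd p) = V (\<not> s) (x + sg s * hd ds)) \<and>
    successively (\<lambda>a b. b \<noteq> a \<and> b \<noteq> star_rev P a) p"
  using assms
proof (induction ds arbitrary: s x)
  case Nil
  then show ?case
    by (intro exI[of _ "[]"]) (simp add: awalk_Nil_iff)
next
  case (Cons d ds)
  then obtain p where p: "awalk (V (\<not> s) (x + sg s * d)) p (path_end (\<not> s) (x + sg s * d) ds)"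
    "length p = length ds"
    "p \<noteq> [] \<longrightarrow> head G (hd p) = V s (x + sg s * d - sg s * hd ds)"
    "successively (\<lambda>a b. b \<noteq> a \<and> b \<noteq> star_rev P a) p"
    using Cons.IH[of "\<not> s" "x + sg s * d"] by (auto simp: successively_Cons)
  obtain a where a: "a \<in> arcs G" "tail G a = V s x" "head G a = V (\<not> s) (x + sg s * d)"
    using arc_exists[of d s x] Cons.prems by auto
  have "hd p \<noteq> a \<and> hd p \<noteq> star_rev P a" if "p \<noteq> []"
  proof -
    have hd: "tail G (hd p) = head G a"
      using p(1) that a(3) by (cases p) (auto simp: awalk_Cons_iff)
    have "ds \<noteq> []"
      using that p(2) by auto
    then have "\<not> d \<simeq> hd ds"
      using Cons.prems by (simp add: successively_Cons)
    then have "\<not> x + (sg s * d - sg s * hd ds) \<simeq> x + 0"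
      by (cases s) (simp_all add: cong_iff_dvd_diff dvd_diff_commute)
    then have "head G (hd p) \<noteq> tail G a"
      using p(3) that a(2) by (simp add: V_eq_iff algebra_simps)
    then show ?thesis
      using hd a(1) snd_tail_head[OF a(1)] by auto
  qed
  then have "successively (\<lambda>a b. b \<noteq> a \<and> b \<noteq> star_rev P a) (a # p)"
    using p(4) unfolding successively_Cons by blast
  moreover have "awalk (V s x) (a # p) (path_end s x (d # ds))"
    using p(1) a by (simp add: awalk_Cons_iff)
  ultimately show ?case
    using p(2) a(3) by (intro exI[of _ "a # p"]) simp
qed

lemma head_out_arcs: "head G ` out_arcs G (V s x) = (\<lambda>d. V (\<not> s) (x + sg s * d)) ` D"
proof
  show "head G ` out_arcs G (V s x) \<subseteq> (\<lambda>d. V (\<not> s) (x + sg s * d)) ` D"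
  proof (rule image_subsetI)
    fix e assume "e \<in> out_arcs G (V s x)"
    then have "\<exists>d\<in>D. head G e = V (\<not> s) (x + sg s * d)"
      by (intro arc_head) (simp_all add: out_arcs_def)
    then show "head G e \<in> (\<lambda>d. V (\<not> s) (x + sg s * d)) ` D"
      by blast
  qed
  show "(\<lambda>d. V (\<not> s) (x + sg s * d)) ` D \<subseteq> head G ` out_arcs G (V s x)"
  proof (rule image_subsetI)
    fix d assume "d \<in> D"
    then obtain e where "e \<in> arcs G" "tail G e = V s x" "head G e = V (\<not> s) (x + sg s * d)"
      using arc_exists by blast
    then show "V (\<not> s) (x + sg s * d) \<in> head G ` out_arcs G (V s x)"
      by (intro image_eqI[of _ _ e]) (simp_all add: out_arcs_def)
  qed
qed

lemma finite_arcs_G: "finite (arcs G)"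
proof (rule finite_subset)
  show "arcs G \<subseteq> {r. set r \<subseteq> {..<n} \<times> UNIV \<and> length r = 3}"
    using n_pos by (auto simp: arcs_G W_def V_def nat_less_iff)
  show "finite {r :: nat letter list. set r \<subseteq> {..<n} \<times> UNIV \<and> length r = 3}"
    by (rule finite_lists_length_eq) simp
qed

lemma finite_out_arcs_G: "finite (out_arcs G v)"
  by (rule finite_subset[OF _ finite_arcs_G]) (auto simp: out_arcs_def)

section \<open>Translations of the star graph\<close>

definition shift :: "int \<Rightarrow> nat letter \<Rightarrow> nat letter" where
  "shift t v = V (snd v) (int (fst v) + t)"

lemma shift_V: "shift t (V s x) = V s (x + t)"
proof -
  have "x mod int n + t \<simeq> x + t"
    by (intro cong_add) (simp_all add: cong_def)
  then show ?thesis
    using n_pos by (simp add: shift_def V_eq_iff) (simp add: V_def)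
qed

lemma map_shift_W: "map (shift t) (W s x d e) = W s (x + t) d e"
  by (simp add: W_def shift_V algebra_simps)

text \<open>Translations are automorphisms of the star graph; since arcs are words, they act on arcs
  letter by letter.\<close>

lemma shift_arc:
  assumes "a \<in> arcs G"
  shows "map (shift t) a \<in> arcs G" "tail G (map (shift t) a) = shift t (tail G a)"
    "head G (map (shift t) a) = shift t (head G a)" "map (shift (- t)) (map (shift t) a) = a"
proof -
  obtain s x d e where a: "a = W s x d e" "(d, e) \<in> steps"
    using assms by (auto simp: arcs_G)
  show "map (shift t) a \<in> arcs G"
    unfolding a map_shift_W using a(2) by (auto simp: arcs_G)
  show "tail G (map (shift t) a) = shift t (tail G a)" "head G (map (shift t) a) = shift t (head G a)"
    unfolding a map_shift_W by (simp_all add: shift_V algebra_simps)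
  show "map (shift (- t)) (map (shift t) a) = a"
    unfolding a map_shift_W by simp
qed

lemma shift_vert:
  assumes "v \<in> verts G"
  shows "shift t v \<in> verts G" "shift (- t) (shift t v) = v"
  using vertsE[OF assms] by (metis shift_V V_in_verts, metis shift_V add.commute minus_add_cancel)

end

section \<open>Perfect difference triples give special presentations\<close>

text \<open>Constancy modulo \<open>h\<close> keeps edges inside a residue class,
  \<open>card_D\<close> gives the degrees, \<open>sidon\<close> excludes short cycles, and
  \<open>cover\<close> provides short walks.\<close>

locale difference_triple = cyclic_triple +
  fixes h :: nat
  assumes h_dvd: "h dvd n"
    and D_mod_h: "\<And>d. d \<in> D \<Longrightarrow> [d = int q1] (mod int h)"
    and card_D: "card D = 3"
    and sidon: "\<And>d1 d2 d3 d4. d1 \<in> D \<Longrightarrow> d2 \<in> D \<Longrightarrow> d3 \<in> D \<Longrightarrow> d4 \<in> D \<Longrightarrow>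
      d1 + d2 \<simeq> d3 + d4 \<Longrightarrow> d1 = d3 \<or> d1 = d4"
    and cover: "\<And>x. [x = 0] (mod int h) \<Longrightarrow> \<exists>d\<in>D. \<exists>e\<in>D. x \<simeq> d - e"
begin

lemma h_pos: "0 < h"
  using h_dvd n_pos by (rule dvd_pos_nat[rotated])

lemma D_inj: "d \<in> D \<Longrightarrow> e \<in> D \<Longrightarrow> d \<simeq> e \<Longrightarrow> d = e"
  using sidon[of d d e e] cong_add[of d e _ d e] by blast

lemma D_distinct: "int q1 \<noteq> int q2" "int q1 \<noteq> q3" "int q2 \<noteq> q3"
  using card_D by (auto simp: D_def card_insert_if split: if_splits)

lemma steps_functional:
  assumes "(d, e) \<in> steps" "(d', e') \<in> steps" "d = d' \<or> e = e'"
  shows "d = d' \<and> e = e'"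
  using assms D_distinct by (auto simp: steps_def)

text \<open>The two ends determine the sign, the subscript and one increment modulo
  \<open>n\<close>. As the increments are distinct, this one determines its partner in
  \<open>steps\<close>, hence the whole word.\<close>

lemma arcs_eqI:
  assumes "a \<in> arcs G" "b \<in> arcs G" "tail G a = tail G b" "head G a = head G b"
  shows "a = b"
proof -
  obtain s x d e where a: "a = W s x d e" "(d, e) \<in> steps"
    using assms by (auto simp: arcs_G)
  obtain t y d' e' where b: "b = W t y d' e'" "(d', e') \<in> steps"
    using assms by (auto simp: arcs_G)
  have t: "t = s" "x \<simeq> y"
    using assms(3) by (auto simp: a b V_eq_iff)
  have "x + sg s * (if s then d else e) \<simeq> y + sg s * (if s then d' else e')"
    using assms(4) by (simp add: a b t head_W_sg V_eq_iff del: head_W)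
  with t(2) have "x + sg s * (if s then d else e) - x \<simeq> y + sg s * (if s then d' else e') - y"
    by (rule cong_diff[rotated])
  then have "(if s then d else e) \<simeq> (if s then d' else e')"
    by (simp add: sg_mult_cancel)
  then have "d = d' \<or> e = e'"
    using D_inj step_D a(2) b(2) by (cases s) auto
  then have "d = d' \<and> e = e'"
    using steps_functional a(2) b(2) by blast
  then show ?thesis
    using a b t W_cong by auto
qed

text \<open>The component of a vertex, as an index modulo \<open>h\<close>: an edge from \<open>i\<close> to \<open>j\<close> has \<open>j - i\<close> congruent to
  \<open>q1\<close> modulo \<open>h\<close>.\<close>

definition \<kappa> :: "nat letter \<Rightarrow> int" where
  "\<kappa> v = (if snd v then int (fst v) else int (fst v) - int q1) mod int h"

lemma \<kappa>_V: "\<kappa> (V s x) = (if s then x else x - int q1) mod int h"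
proof -
  have "x mod int n mod int h = x mod int h"
    using h_dvd by (simp add: mod_mod_cancel)
  moreover from this have "(x mod int n - int q1) mod int h = (x - int q1) mod int h"
    by (metis mod_diff_left_eq)
  ultimately show ?thesis
    using n_pos by (simp add: \<kappa>_def V_def)
qed

lemma \<kappa>_invariant:
  assumes "e \<in> arcs G"
  shows "\<kappa> (tail G e) = \<kappa> (head G e)"
proof -
  obtain s x where x: "tail G e = V s x"
    using vertsE[OF tail_in_verts[OF assms]] by blast
  then obtain d where d: "d \<in> D" "head G e = V (\<not> s) (x + sg s * d)"
    using arc_head assms by blast
  have "[x = x + d - int q1] (mod int h)" "[x - int q1 = x - d] (mod int h)"
    using D_mod_h[OF d(1)] by (auto simp: cong_iff_dvd_diff dvd_diff_commute)
  then show ?thesis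
    by (simp add: x d \<kappa>_V cong_def)
qed

section \<open>Short walks and components\<close>

lemma step_awalk:
  assumes "d \<in> D" "awalk (V (\<not> s) (x + sg s * d)) p v"
  shows "\<exists>e. awalk (V s x) (e # p) v"
proof -
  obtain e where "e \<in> arcs G" "tail G e = V s x" "head G e = V (\<not> s) (x + sg s * d)"
    using arc_exists[OF assms(1)] by blast
  then show ?thesis
    using assms(2) by (intro exI[of _ e]) (simp add: awalk_Cons_iff)
qed

text \<open>The difference of the subscripts is a multiple of \<open>h\<close>, so
  \<open>cover\<close> writes it as \<open>d - e\<close>: one step \<open>d\<close> forward and one
  step \<open>e\<close> back.\<close>

lemma short_awalk_same_sign:
  assumes "\<kappa> (V s x) = \<kappa> (V s y)"
  shows "\<exists>p. awalk (V s x) p (V s y) \<and> length p = 2"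
proof -
  have "[x = y] (mod int h)"
  proof (cases s)
    case False
    then have "[x - int q1 = y - int q1] (mod int h)"
      using assms by (simp add: \<kappa>_V cong_def)
    then show ?thesis
      by (simp add: cong_iff_dvd_diff)
  qed (use assms in \<open>simp add: \<kappa>_V cong_def\<close>)
  then have "[sg s * (y - x) = 0] (mod int h)"
    by (cases s) (simp_all add: cong_iff_dvd_diff dvd_diff_commute)
  from cover[OF this] obtain d e where d: "d \<in> D" "e \<in> D" "sg s * (y - x) \<simeq> d - e"
    by blast
  have "x + sg s * d - sg s * e \<simeq> y"
    using d(3) by (cases s) (simp_all add: cong_iff_dvd_diff algebra_simps dvd_diff_commute)
  then have "V s (x + sg s * d - sg s * e) = V s y"
    by (simp add: V_eq_iff)
  then have "awalk (V s (x + sg s * d - sg s * e)) [] (V s y)"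
    by (simp add: awalk_Nil_iff)
  then obtain a where "awalk (V (\<not> s) (x + sg s * d)) [a] (V s y)"
    using step_awalk[OF d(2), of "\<not> s" "x + sg s * d" "[]" "V s y"] by auto
  from step_awalk[OF d(1) this] obtain b where "awalk (V s x) [b, a] (V s y)"
    by blast
  then show ?thesis
    by (intro exI[of _ "[b, a]"]) simp
qed

text \<open>Vertices of opposite sign are brought to the same sign by one arbitrary step, here
  \<open>int q1\<close>, which stays in the component.\<close>

lemma short_awalk:
  assumes "u \<in> verts G" "v \<in> verts G" "\<kappa> u = \<kappa> v"
  shows "\<exists>p. awalk u p v \<and> length p \<le> 3"
proof -
  obtain s x where u: "u = V s x"
    using vertsE[OF assms(1)] by blast
  obtain t y where v: "v = V t y"
    using vertsE[OF assms(2)] by blast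
  note uv = u v
  show ?thesis
  proof (cases "s = t")
    case True
    then obtain p where "awalk u p v" "length p = 2"
      using short_awalk_same_sign[of s x y] assms(3) uv by blast
    then show ?thesis
      by (intro exI[of _ p]) simp
  next
    case False
    have q1: "int q1 \<in> D"
      by (simp add: D_def)
    have "t = (\<not> s)"
      using False by blast
    then obtain a where a: "a \<in> arcs G" "tail G a = V s x" "head G a = V t (x + sg s * int q1)"
      using arc_exists[OF q1, of s x] by blast
    then have "\<kappa> (V t (x + sg s * int q1)) = \<kappa> (V t y)"
      using \<kappa>_invariant[of a] assms(3) by (simp add: uv)
    then obtain p where "awalk (V t (x + sg s * int q1)) p (V t y)" "length p = 2"
      using short_awalk_same_sign by blast
    then have "awalk u (a # p) v" "length (a # p) = 3"
      using a uv by (auto simp: awalk_Cons_iff)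
    then show ?thesis
      by (intro exI[of _ "a # p"]) simp
  qed
qed

lemma \<kappa>_image: "\<kappa> ` verts G = {0..<int h}"
proof -
  have "r \<in> \<kappa> ` verts G" if "r \<in> {0..<int h}" for r
    using that by (intro image_eqI[of _ _ "V True r"]) (simp_all add: \<kappa>_V)
  then show ?thesis
    using h_pos by (auto simp: \<kappa>_def)
qed

abbreviation component :: "int \<Rightarrow> (nat letter, nat letter list) pre_digraph" where
  "component r \<equiv> G \<restriction> {v \<in> verts G. \<kappa> v = r}"

lemma sccs_G: "sccs = component ` {0..<int h}" and card_sccs_G: "card sccs = h"
proof -
  have conn: "u \<rightarrow>\<^sup>*\<^bsub>G\<^esub> v" if "u \<in> verts G" "v \<in> verts G" "\<kappa> u = \<kappa> v" for u v
    using short_awalk[OF that] unfolding reachable_awalk by blast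
  show "sccs = component ` {0..<int h}"
    by (rule sccs_invariant(1)[of \<kappa>, unfolded \<kappa>_image]) (rule \<kappa>_invariant conn; assumption)+
  have "card sccs = card {0..<int h}"
    by (rule sccs_invariant(2)[of \<kappa>, unfolded \<kappa>_image]) (rule \<kappa>_invariant conn; assumption)+
  then show "card sccs = h"
    by simp
qed

lemma awalk_comp: "\<kappa> u = r \<Longrightarrow> pre_digraph.awalk (component r) u p v \<longleftrightarrow> awalk u p v"
  using awalk_induce_invariant[of \<kappa>] \<kappa>_invariant by blast

lemma awalk_parity: "awalk u p v \<Longrightarrow> snd u = snd v \<longleftrightarrow> even (length p)"
proof (induction p arbitrary: u)
  case (Cons e p)
  then have e: "e \<in> arcs G" "tail G e = u" "awalk (head G e) p v"
    by (auto simp: awalk_Cons_iff)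
  obtain s x where x: "tail G e = V s x"
    using vertsE[OF tail_in_verts[OF e(1)]] by blast
  then obtain d where "head G e = V (\<not> s) (x + sg s * d)"
    using arc_head[OF e(1) x] by blast
  then have "snd (head G e) \<longleftrightarrow> \<not> snd u"
    using x e(2) by (auto simp: V_def)
  then show ?case
    using Cons.IH[OF e(3)] by auto
qed (simp add: awalk_Nil_iff)

lemma bipartite_comp: "bipartite (component r)"
proof -
  have *: "snd (tail G e) \<noteq> snd (head G e)" if "e \<in> arcs G" for e
    using awalk_parity[OF arc_implies_awalk[OF that]] by simp
  let ?A = "{v \<in> verts (component r). snd v}" and ?B = "{v \<in> verts (component r). \<not> snd v}"
  have "tail (component r) e \<in> ?A \<and> head (component r) e \<in> ?B \<or> tail (component r) e \<in> ?B \<and> head (component r) e \<in> ?A"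
    if "e \<in> arcs (component r)" for e
    using *[of e] that by simp
  moreover have "?A \<union> ?B = verts (component r)" "?A \<inter> ?B = {}"
    by blast+
  ultimately show ?thesis
    unfolding bipartite_def by blast
qed

end

section \<open>Girth, diameter, degree and isomorphism of the components\<close>

context difference_triple
begin

text \<open>Repeating the step would lead back to the tail of \<open>a\<close>; without parallel
  edges, \<open>b\<close> would then be the reverse of \<open>a\<close>.\<close>

lemma reduced_step:
  assumes "a \<in> arcs G" "tail G a = V s x" "head G a = V (\<not> s) (x + sg s * d)"
    and "b \<in> arcs G" "tail G b = head G a" "b \<noteq> star_rev P a"
  shows "\<exists>e\<in>D. e \<noteq> d \<and> head G b = V s (x + sg s * d - sg s * e)"
proof -
  obtain e where e: "e \<in> D" "head G b = V s (x + sg s * d - sg s * e)"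
    using arc_head[of b "\<not> s" "x + sg s * d"] assms by auto
  moreover have "e \<noteq> d"
  proof
    assume "e = d"
    then have "head G b = head G (star_rev P a)"
      using assms(1,2) e by simp
    then show False
      using arcs_eqI[of b "star_rev P a"] assms by simp
  qed
  ultimately show ?thesis
    by blast
qed

text \<open>By parity only lengths 2 and 4 remain. Length 2 makes two different steps congruent.
  Length 4 gives \<open>d + d' \<simeq> e + e'\<close>, and \<open>sidon\<close> with
  \<open>d \<noteq> e\<close> and \<open>d' \<noteq> e'\<close> forces \<open>d' = e\<close>, a
  backtracking.\<close>

lemma girth_comp_ge:
  assumes "closed_reduced_path (component r) (star_rev P) p"
  shows "6 \<le> length p"
proof (rule ccontr)
  assume "\<not> 6 \<le> length p"
  obtain u where u: "pre_digraph.awalk (component r) u p u" "p \<noteq> []"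
    and red: "\<And>i. Suc i < length p \<Longrightarrow> p ! Suc i \<noteq> star_rev P (p ! i)"
    using assms by (auto simp: closed_reduced_path_def)
  from u(1) have "\<kappa> u = r"
    by (simp add: pre_digraph.awalk_def)
  with u(1) have aw: "awalk u p u"
    by (simp add: awalk_comp)
  then have "even (length p)"
    using awalk_parity by blast
  with u(2) \<open>\<not> 6 \<le> length p\<close> have "length p = 2 \<or> length p = 4"
    unfolding length_greater_0_conv[symmetric] by presburger
  obtain s x where x: "u = V s x"
    using vertsE[OF awalk_hd_in_verts[OF aw]] by blast
  obtain a b p' where p: "p = a # b # p'"
    using \<open>length p = 2 \<or> length p = 4\<close> by (cases p rule: remdups_adj.cases) auto
  have ab: "a \<in> arcs G" "b \<in> arcs G" "tail G a = V s x" "tail G b = head G a" "b \<noteq> star_rev P a"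
    "awalk (head G b) p' (V s x)"
    using aw red[of 0] by (auto simp: p x awalk_Cons_iff)
  obtain d where d: "d \<in> D" "head G a = V (\<not> s) (x + sg s * d)"
    using arc_head ab by blast
  obtain e where e: "e \<in> D" "e \<noteq> d" "head G b = V s (x + sg s * d - sg s * e)"
    using reduced_step[OF ab(1) ab(3) d(2) ab(2) ab(4) ab(5)] by blast
  from \<open>length p = 2 \<or> length p = 4\<close> show False
  proof
    assume "length p = 2"
    then have "V s (x + sg s * d - sg s * e) = V s x"
      using ab(6) e(3) by (simp add: p awalk_Nil_iff)
    then have "d \<simeq> e"
      by (cases s) (simp_all add: V_eq_iff cong_iff_dvd_diff dvd_diff_commute)
    then show False
      using D_inj d e by blast
  next
    assume "length p = 4"
    then obtain a' b' where p': "p' = [a', b']"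
      by (auto simp: p length_Suc_conv eval_nat_numeral)
    have ab': "a' \<in> arcs G" "b' \<in> arcs G" "tail G a' = head G b" "tail G b' = head G a'"
      "a' \<noteq> star_rev P b" "b' \<noteq> star_rev P a'" "head G b' = V s x"
      using ab(6) red[of 1] red[of 2] by (auto simp: p p' awalk_Cons_iff awalk_Nil_iff)
    let ?y = "x + sg s * d - sg s * e"
    have "tail G b = V (\<not> s) (x + sg s * d)" "head G b = V (\<not> \<not> s) (x + sg s * d + sg (\<not> s) * e)"
      using ab(4) d e by simp_all
    from reduced_step[OF ab(2) this ab'(1) ab'(3) ab'(5)]
    obtain d' where d': "d' \<in> D" "d' \<noteq> e" "head G a' = V (\<not> s) (?y + sg s * d')"
      by auto
    have "tail G a' = V s ?y"
      using ab'(3) e(3) by simp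
    from reduced_step[OF ab'(1) this d'(3) ab'(2) ab'(4) ab'(6)]
    obtain e' where e': "e' \<in> D" "e' \<noteq> d'" "head G b' = V s (?y + sg s * d' - sg s * e')"
      by blast
    have "?y + sg s * d' - sg s * e' \<simeq> x"
      using ab'(7) e'(3) by (simp add: V_eq_iff)
    then have "d + d' \<simeq> e + e'"
      by (cases s) (simp_all add: cong_iff_dvd_diff dvd_diff_commute algebra_simps)
    then have "d = e'" "d' = e"
      using sidon[of d d' e e'] sidon[of d' d e e'] d(1) e(1,2) d'(1) e'(1,2) by (auto simp: add.commute)
    then show False
      using d'(2) by blast
  qed
qed

lemma girth_comp:
  assumes "r \<in> {0..<int h}"
  shows "girth (component r) (star_rev P) = enat 6"
proof -
  have ne: "\<not> d \<simeq> e" if "d \<in> D" "e \<in> D" "d \<noteq> e" for d e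
    using D_inj that by blast
  \<comment> \<open>A hexagon: neighbouring steps differ, and in the alternating sum every increment
    occurs once with each sign.\<close>
  let ?ds = "[int q1, int q2, q3, int q1, int q2, q3]"
  have D: "int q1 \<in> D" "int q2 \<in> D" "q3 \<in> D"
    by (simp_all add: D_def)
  then have "successively (\<lambda>d e. \<not> d \<simeq> e) ?ds"
    using D_distinct ne[of "int q1" "int q2"] ne[of "int q2" q3] ne[of q3 "int q1"] by simp
  moreover have "path_end True r ?ds = V True r"
    by simp
  ultimately obtain p where p: "awalk (V True r) p (V True r)" "length p = 6"
    "successively (\<lambda>a b. b \<noteq> a \<and> b \<noteq> star_rev P a) p"
    using reduced_awalk_exists[of ?ds True r] D by auto
  have "pre_digraph.awalk (component r) (V True r) p (V True r)"
    using p(1) assms by (simp add: awalk_comp \<kappa>_V)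
  moreover have "p \<noteq> []"
    using p(2) by auto
  ultimately have "closed_reduced_path (component r) (star_rev P) p"
    using p(3) unfolding closed_reduced_path_def successively_conv_nth by blast
  then show ?thesis
    using p(2) girth_comp_ge by (rule girth_eqI)
qed

lemma diameter_comp:
  assumes "r \<in> {0..<int h}"
  shows "diameter (component r) = ereal (real 3)"
proof -
  interpret C: wf_digraph "component r"
    by (rule wellformed_induce_subgraph)
  \<comment> \<open>Three steps lead from \<open>V True r\<close> to this vertex. An edge of step
    \<open>d\<close> would give \<open>int q1 + q3 \<simeq> int q2 + d\<close>, against
    \<open>sidon\<close>.\<close>
  let ?v = "V False (r + int q1 - int q2 + q3)"
  have r: "\<kappa> (V True r) = r"
    using assms by (simp add: \<kappa>_V)
  have "[int q2 = int q1] (mod int h)" "[q3 = int q1] (mod int h)"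
    using D_mod_h by (simp_all add: D_def)
  then have "[int q2 - q3 = int q1 - int q1] (mod int h)"
    by (rule cong_diff)
  then have "[r - int q2 + q3 = r] (mod int h)"
    by (simp add: cong_iff_dvd_diff dvd_diff_commute)
  then have v: "\<kappa> ?v = r"
    using assms by (simp add: \<kappa>_V cong_def algebra_simps)
  show ?thesis
  proof (rule C.diameter_eqI)
    show "\<exists>p. C.awalk u p v \<and> length p \<le> 3" if "u \<in> verts (component r)" "v \<in> verts (component r)" for u v
      using that short_awalk[of u v] by (auto simp: awalk_comp)
    show "V True r \<in> verts (component r)" "?v \<in> verts (component r)"
      using r v by simp_all
    fix p assume "C.awalk (V True r) p ?v"
    then have aw: "awalk (V True r) p ?v"
      using r by (simp add: awalk_comp)
    then have "odd (length p)"
      using awalk_parity by (force simp: V_def)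
    moreover have "length p \<noteq> 1"
    proof
      assume "length p = 1"
      then obtain a where "p = [a]"
        by (auto simp: length_Suc_conv)
      then have "a \<in> arcs G" "tail G a = V True r" "head G a = ?v"
        using aw by (auto simp: awalk_Cons_iff awalk_Nil_iff)
      then obtain d where d: "d \<in> D" "?v = V False (r + d)"
        using arc_head[of a True r] by auto
      then have "int q1 + q3 \<simeq> int q2 + d" "q3 + int q1 \<simeq> int q2 + d"
        by (simp_all add: V_eq_iff cong_iff_dvd_diff algebra_simps)
      then have "int q1 = d" "q3 = d"
        using sidon[of "int q1" q3 "int q2" d] sidon[of q3 "int q1" "int q2" d] d(1) D_distinct
        by (auto simp: D_def)
      then show False
        using D_distinct by simp
    qed
    ultimately show "3 \<le> length p"
      by presburger
  qed
qed

lemma out_degree_comp: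
  assumes "v \<in> verts (component r)"
  shows "3 \<le> out_degree (component r) v"
proof -
  have v: "v \<in> verts G" "\<kappa> v = r"
    using assms by auto
  \<comment> \<open>Passing to the component loses no arc at \<open>v\<close>, because the other end
    lies in the same fibre.\<close>
  then have eq: "out_arcs (component r) v = out_arcs G v"
    by (auto simp: out_arcs_def simp flip: \<kappa>_invariant)
  obtain s x where x: "v = V s x"
    using vertsE[OF v(1)] by blast
  have "inj_on (\<lambda>d. V (\<not> s) (x + sg s * d)) D"
    by (rule inj_onI) (simp add: V_eq_iff cong_add_lcancel sg_mult_cancel D_inj)
  then have "3 = card (head G ` out_arcs G v)"
    by (simp add: x head_out_arcs card_image card_D)
  also have "\<dots> \<le> card (out_arcs G v)"
    by (rule card_image_le[OF finite_out_arcs_G])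
  finally show ?thesis
    by (simp add: out_degree_def eq)
qed

lemma \<kappa>_shift:
  assumes "v \<in> verts G"
  shows "\<kappa> (shift t v) = (\<kappa> v + t) mod int h"
proof -
  obtain s x where "v = V s x"
    using vertsE[OF assms] by blast
  then show ?thesis
    by (simp add: shift_V \<kappa>_V mod_simps algebra_simps)
qed

text \<open>Translation by \<open>r' - r\<close> moves one fibre onto the other, with the opposite
  translation as inverse.\<close>

lemma digraph_iso_comp:
  assumes "r \<in> {0..<int h}" "r' \<in> {0..<int h}"
  shows "digraph_iso (component r) (component r')"
proof -
  interpret C: wf_digraph "component r"
    by (rule wellformed_induce_subgraph)
  define t where "t = r' - r"
  let ?f = "\<lparr>iso_verts = shift t, iso_arcs = map (shift t), iso_head = head G, iso_tail = tail G\<rparr>"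
  have into: "\<kappa> (shift t v) = r'" if "v \<in> verts G" "\<kappa> v = r" for v
    using assms that by (simp add: \<kappa>_shift t_def)
  have shift_back: "\<kappa> (shift (- t) v) = r" if "v \<in> verts G" "\<kappa> v = r'" for v
    using assms that by (simp add: \<kappa>_shift t_def)
  have "C.digraph_isomorphism ?f"
    unfolding C.digraph_isomorphism_def
  proof (intro conjI ballI)
    show "inj_on (iso_verts ?f) (verts (component r))"
      by (rule inj_on_inverseI[of _ "shift (- t)"]) (simp add: shift_vert)
    show "inj_on (iso_arcs ?f) (arcs (component r))"
      by (rule inj_on_inverseI[of _ "map (shift (- t))"]) (simp add: shift_arc del: map_map)
  qed (auto simp: shift_arc)
  moreover have "component r' = app_iso ?f (component r)"
  proof (rule pre_digraph.equality)
    show "verts (component r') = verts (app_iso ?f (component r))"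
    proof (intro equalityI subsetI)
      fix v assume "v \<in> verts (component r')"
      then have "shift (- t) v \<in> verts (component r)" "v = shift t (shift (- t) v)"
        using shift_back shift_vert[of v "- t"] by auto
      then show "v \<in> verts (app_iso ?f (component r))"
        unfolding app_iso_simps digraph_isomorphism.simps by (rule rev_image_eqI)
    qed (auto simp: into shift_vert)
    show "arcs (component r') = arcs (app_iso ?f (component r))"
    proof (intro equalityI subsetI)
      fix a assume "a \<in> arcs (component r')"
      then have "map (shift (- t)) a \<in> arcs (component r)" "a = map (shift t) (map (shift (- t)) a)"
        using shift_back shift_arc[of a "- t"] by (auto simp: shift_vert(1) simp del: map_map)
      then show "a \<in> arcs (app_iso ?f (component r))"
        unfolding app_iso_simps digraph_isomorphism.simps by (rule rev_image_eqI)
    qed (auto simp: into shift_arc shift_vert(1))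
  qed simp_all
  ultimately show ?thesis
    unfolding digraph_iso_def by blast
qed

lemma length_rels: "r \<in> rels P \<Longrightarrow> length r = 3"
  by (auto simp: rels_P)

theorem special_P: "special_presentation 3 3 \<nu> P \<longleftrightarrow> \<nu> = h"
proof -
  have "out_degree (component r) v \<ge> 3" if "v \<in> verts (component r)" for r v
    using out_degree_comp that by blast
  then show ?thesis
    unfolding special_presentation_def Let_def
    using finite_presentation_P h_pos length_rels card_sccs_G digraph_iso_comp
    by (auto simp: sccs_G bipartite_comp diameter_comp girth_comp)
qed

end

section \<open>Special presentations come from perfect difference triples\<close>

context cyclic_triple
begin

text \<open>Unlike in \<open>reduced_awalk_exists\<close>, equal consecutive steps are allowed, as
  only reachability matters.\<close>

lemma awalk_exists:
  assumes "set ds \<subseteq> D"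
  shows "\<exists>p. awalk (V s x) p (path_end s x ds)"
  using assms
proof (induction ds arbitrary: s x)
  case Nil
  then show ?case
    by (intro exI[of _ "[]"]) (simp add: awalk_Nil_iff)
next
  case (Cons d ds)
  then obtain p where p: "awalk (V (\<not> s) (x + sg s * d)) p (path_end s x (d # ds))"
    by fastforce
  obtain a where a: "a \<in> arcs G" "tail G a = V s x" "head G a = V (\<not> s) (x + sg s * d)"
    using arc_exists[of d s x] Cons.prems by auto
  then have "awalk (V s x) (a # p) (path_end s x (d # ds))"
    using p unfolding awalk_Cons_iff by simp
  then show ?case
    by blast
qed

end

locale special_triple = cyclic_triple +
  fixes \<nu> :: nat
  assumes special: "special_presentation 3 3 \<nu> P"
begin

text \<open>The girth is given for components only, but a closed walk stays inside one of
  them.\<close>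

lemma girth_ge:
  assumes "closed_reduced_path G (star_rev P) p"
  shows "6 \<le> length p"
proof -
  obtain u where u: "awalk u p u"
    using assms by (auto simp: closed_reduced_path_def)
  then have "u \<in> verts G"
    by (rule awalk_hd_in_verts)
  then have "girth (component_of u) (star_rev P) = enat (2 * 3)"
    using special component_of_in_sccs unfolding special_presentation_def Let_def by blast
  moreover have "closed_reduced_path (component_of u) (star_rev P) p"
    using assms u awalk_component_of unfolding closed_reduced_path_def by blast
  ultimately show ?thesis
    using girth_le by fastforce
qed

lemma short_awalk:
  assumes "u \<rightarrow>\<^sup>*\<^bsub>G\<^esub> v"
  shows "\<exists>p. awalk u p v \<and> length p \<le> 3"
proof -
  interpret C: wf_digraph "component_of u"
    by (rule wellformed_induce_subgraph)
  have uv: "u \<in> verts G" "v \<in> verts G"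
    using assms by (auto dest: reachable_in_verts)
  then have "diameter (component_of u) = ereal (real 3)"
    using special component_of_in_sccs unfolding special_presentation_def Let_def by blast
  moreover have "scc_of u = scc_of v"
    using assms awalk_invariant[of scc_of u, OF scc_of_arc] unfolding reachable_awalk by blast
  ultimately obtain p where "C.awalk u p v" "length p \<le> 3"
    using C.short_awalk_if_diameter[of 3 u v] uv by auto
  then show ?thesis
    using awalk_component_of by blast
qed

text \<open>Two parallel edges, one followed forwards and the other backwards, would form a closed
  reduced path of length 2.\<close>

lemma arcs_eqI:
  assumes "a \<in> arcs G" "b \<in> arcs G" "tail G a = tail G b" "head G a = head G b"
  shows "a = b"
proof (rule ccontr)
  assume "a \<noteq> b"
  have "star_rev P b \<noteq> a" "star_rev P b \<noteq> star_rev P a"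
    using \<open>a \<noteq> b\<close> assms snd_tail_head[of b] by (auto simp: arev_eq_iff)
  moreover have "awalk (tail G a) [a, star_rev P b] (tail G a)"
    using assms by (simp add: awalk_Cons_iff awalk_Nil_iff)
  ultimately have "closed_reduced_path G (star_rev P) [a, star_rev P b]"
    unfolding closed_reduced_path_def by (intro conjI exI[of _ "tail G a"]) auto
  then show False
    using girth_ge by force
qed

text \<open>Without parallel edges the degree of \<open>V True 0\<close> is the number of residues
  of \<open>D\<close> modulo \<open>n\<close>. It is at least 3 while \<open>D\<close> has at most
  three elements, so equality holds throughout.\<close>

lemma card_D: "card D = 3" and D_inj: "inj_on (\<lambda>d. d mod int n) D"
proof -
  let ?v = "V True 0" and ?f = "\<lambda>d. V False d"
  have "out_arcs (component_of ?v) ?v \<subseteq> out_arcs G ?v"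
    by (auto simp: out_arcs_def)
  then have "out_degree (component_of ?v) ?v \<le> card (out_arcs G ?v)"
    unfolding out_degree_def by (rule card_mono[OF finite_out_arcs_G])
  moreover have "3 \<le> out_degree (component_of ?v) ?v"
    using special component_of_in_sccs[of ?v] unfolding special_presentation_def Let_def by auto
  moreover have "inj_on (head G) (out_arcs G ?v)"
    by (rule inj_onI) (auto simp: out_arcs_def intro: arcs_eqI)
  then have "card (out_arcs G ?v) = card (?f ` D)"
    using head_out_arcs[of True 0] by (simp flip: card_image)
  moreover have "finite D" "card D \<le> 3"
    by (simp_all add: D_def card_insert_if)
  moreover have "card (?f ` D) \<le> card D"
    by (rule card_image_le) (simp add: D_def)
  ultimately have "card (?f ` D) = card D" "card D = 3" "finite D"
    by linarith+
  then have "inj_on ?f D"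
    by (intro eq_card_imp_inj_on)
  then show "inj_on (\<lambda>d. d mod int n) D"
    by (auto simp: inj_on_def V_eq_iff cong_def)
  show "card D = 3"
    by fact
qed

text \<open>A nontrivial coincidence of sums closes up the walk with steps \<open>d1\<close>,
  \<open>d3\<close>, \<open>d2\<close>, \<open>d4\<close>, whose alternating sum is 0. It is
  reduced: congruent neighbours would make the remaining two steps congruent as well. Its length 4
  contradicts the girth.\<close>

lemma sidon:
  assumes "d1 \<in> D" "d2 \<in> D" "d3 \<in> D" "d4 \<in> D" "d1 + d2 \<simeq> d3 + d4"
  shows "d1 = d3 \<or> d1 = d4"
proof (rule ccontr)
  assume "\<not> ?thesis"
  then have ne: "\<not> d1 \<simeq> d3" "\<not> d1 \<simeq> d4"
    using D_inj assms by (auto simp: inj_on_def cong_def)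
  have "\<not> d3 \<simeq> d2"
  proof
    assume "d3 \<simeq> d2"
    then have "d1 + d2 - d2 \<simeq> d3 + d4 - d3"
      using assms(5) by (intro cong_diff) (auto simp: cong_sym)
    then show False
      using ne by simp
  qed
  moreover have "\<not> d2 \<simeq> d4"
  proof
    assume "d2 \<simeq> d4"
    then have "d1 + d2 - d2 \<simeq> d3 + d4 - d4"
      using assms(5) by (intro cong_diff)
    then show False
      using ne by simp
  qed
  ultimately obtain p where p: "awalk (V True 0) p (path_end True 0 [d1, d3, d2, d4])" "length p = 4"
    "successively (\<lambda>a b. b \<noteq> a \<and> b \<noteq> star_rev P a) p"
    using reduced_awalk_exists[of "[d1, d3, d2, d4]" True 0] ne assms(1-4) by auto
  have "path_end True 0 [d1, d3, d2, d4] = V True 0"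
    using assms(5) by (simp add: V_eq_iff cong_iff_dvd_diff algebra_simps)
  moreover have "p \<noteq> []"
    using p(2) by auto
  ultimately have "closed_reduced_path G (star_rev P) p"
    using p(1,3) unfolding closed_reduced_path_def successively_conv_nth by metis
  then show False
    using girth_ge p(2) by force
qed

text \<open>A walk of length at most 3 between generators has length 0 or 2 by parity, and length 2
  is one step forward and one back.\<close>

lemma difference_if_reachable:
  assumes "V True 0 \<rightarrow>\<^sup>*\<^bsub>G\<^esub> V True z"
  shows "\<exists>d\<in>D. \<exists>e\<in>D. z \<simeq> d - e"
proof -
  obtain p where p: "awalk (V True 0) p (V True z)" "length p \<le> 3"
    using short_awalk assms by blast
  consider "p = []" | a where "p = [a]" | a b where "p = [a, b]" | a b c where "p = [a, b, c]"
    using p(2) by (auto simp: le_Suc_eq length_Suc_conv eval_nat_numeral)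
  then show ?thesis
  proof cases
    case 1
    then have "z \<simeq> int q1 - int q1"
      using p(1) by (simp add: awalk_Nil_iff V_eq_iff cong_sym_eq)
    moreover have "int q1 \<in> D"
      by (simp add: D_def)
    ultimately show ?thesis
      by blast
  next
    case 2
    then show ?thesis
      using p(1) snd_tail_head[of a] by (auto simp: awalk_Cons_iff awalk_Nil_iff V_def)
  next
    case 3
    then have ab: "a \<in> arcs G" "b \<in> arcs G" "tail G a = V True 0" "tail G b = head G a"
      "head G b = V True z"
      using p(1) by (auto simp: awalk_Cons_iff awalk_Nil_iff)
    then obtain d where d: "d \<in> D" "tail G b = V False d"
      using arc_head[of a True 0] by auto
    then obtain e where "e \<in> D" "V True z = V True (d - e)"
      using arc_head[of b False d] ab by auto
    then show ?thesis
      using d by (auto simp: V_eq_iff)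
  next
    case 4
    then have "snd (V True z) \<longleftrightarrow> \<not> snd (V True 0)"
      using p(1) snd_tail_head[of a] snd_tail_head[of b] snd_tail_head[of c]
      by (auto simp: awalk_Cons_iff awalk_Nil_iff)
    then show ?thesis
      by (simp add: V_def)
  qed
qed

text \<open>Two differences in succession form a walk of four steps, which the diameter bound
  replaces by a shorter one.\<close>

lemma difference_add:
  assumes "d \<in> D" "e \<in> D" "d' \<in> D" "e' \<in> D"
  shows "\<exists>f\<in>D. \<exists>g\<in>D. (d - e) + (d' - e') \<simeq> f - g"
proof -
  have "path_end True 0 [d, e, d', e'] = V True ((d - e) + (d' - e'))"
    by (simp add: algebra_simps)
  then have "V True 0 \<rightarrow>\<^sup>*\<^bsub>G\<^esub> V True ((d - e) + (d' - e'))"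
    using awalk_exists[of "[d, e, d', e']" True 0] assms unfolding reachable_awalk by simp
  then show ?thesis
    by (rule difference_if_reachable)
qed

section \<open>The group of seven differences\<close>

definition differences :: "int set" where
  "differences = (\<lambda>(d, e). (d - e) mod int n) ` (D \<times> D)"

lemma card_differences: "card differences = 7"
proof -
  let ?S = "{(d, e). d \<in> D \<and> e \<in> D \<and> d \<noteq> e}"
  let ?f = "\<lambda>(d, e). (d - e) mod int n"
  have ne: "int q1 \<noteq> int q2" "int q1 \<noteq> q3" "int q2 \<noteq> q3"
    using card_D by (auto simp: D_def card_insert_if split: if_splits)
  have eq: "d = d' \<and> e = e'"
    if "d \<in> D" "e \<in> D" "d' \<in> D" "e' \<in> D" "d \<noteq> e" "d - e \<simeq> d' - e'" for d e d' e'
  proof -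
    have "d + e' \<simeq> d' + e"
      using that(6) by (simp add: cong_iff_dvd_diff algebra_simps)
    then have "d = d'"
      using sidon that by blast
    moreover from this have "e' \<simeq> e"
      using \<open>d + e' \<simeq> d' + e\<close> by (simp add: cong_add_lcancel)
    ultimately show ?thesis
      using D_inj that by (auto simp: inj_on_def cong_def)
  qed
  have "differences = insert 0 (?f ` ?S)"
  proof -
    have DD: "D \<times> D = (\<lambda>d. (d, d)) ` D \<union> ?S"
      by auto
    moreover have "?f ` (\<lambda>d. (d, d)) ` D = {0}"
      by (auto simp: D_def)
    ultimately show ?thesis
      unfolding differences_def DD image_Un by simp
  qed
  moreover have "0 \<notin> ?f ` ?S"
  proof
    assume "0 \<in> ?f ` ?S"
    then obtain d e where "(d, e) \<in> ?S" "?f (d, e) = 0"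
      by (metis (no_types, lifting) imageE surj_pair)
    then have de: "d \<in> D" "e \<in> D" "d \<noteq> e" "(d - e) mod int n = 0"
      unfolding mem_Collect_eq prod.case by blast+
    \<comment> \<open>A vanishing difference is compared with the diagonal pair
      \<open>(int q1, int q1)\<close>, which \<open>eq\<close> admits as its second pair.\<close>
    have "d - e \<simeq> int q1 - int q1"
      unfolding cong_def diff_self using de(4) by (rule trans) (rule mod_0[symmetric])
    moreover have "int q1 \<in> D"
      by (simp add: D_def)
    ultimately show False
      using eq[of d e "int q1" "int q1"] de(1-3) by blast
  qed
  moreover have "inj_on ?f ?S"
  proof (rule inj_onI)
    fix x y assume xy: "x \<in> ?S" "y \<in> ?S" "?f x = ?f y"
    then obtain d e d' e' where "x = (d, e)" "y = (d', e')"
      by (metis surj_pair)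
    then show "x = y"
      using xy eq[of d e d' e'] unfolding mem_Collect_eq cong_def by simp
  qed
  moreover have "?S = {(int q1, int q2), (int q1, q3), (int q2, int q1), (int q2, q3),
      (q3, int q1), (q3, int q2)}"
    using ne by (auto simp: D_def)
  then have "card ?S = 6" "finite ?S"
    using ne by simp_all
  ultimately show ?thesis
    by (simp add: card_image)
qed

lemma n_ge_7: "7 \<le> n"
proof -
  have "differences \<subseteq> {0..<int n}"
    using n_pos by (auto simp: differences_def)
  then have "card differences \<le> card {0..<int n}"
    by (rule card_mono[rotated]) simp
  then show ?thesis
    by (simp add: card_differences)
qed

text \<open>Adding \<open>d - e\<close> permutes the seven residues in \<open>differences\<close>:
  \<open>difference_add\<close> gives closure, and injectivity on a finite set does the rest. The
  sum is unchanged, yet it grows by \<open>7 * (d - e)\<close>.\<close>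

lemma seven_difference:
  assumes "d \<in> D" "e \<in> D"
  shows "7 * (d - e) \<simeq> 0"
proof -
  let ?f = "\<lambda>y. (d - e + y) mod int n"
  have "finite differences"
    by (simp add: differences_def D_def)
  have "?f y \<in> differences" if "y \<in> differences" for y
  proof -
    obtain d' e' where y: "d' \<in> D" "e' \<in> D" "y = (d' - e') mod int n"
      using \<open>y \<in> differences\<close> by (auto simp: differences_def)
    then obtain f g where "f \<in> D" "g \<in> D" "(d - e) + (d' - e') \<simeq> f - g"
      using difference_add assms by blast
    then have "?f y = (f - g) mod int n"
      using y(3) by (simp add: cong_def mod_add_right_eq)
    then show ?thesis
      using \<open>f \<in> D\<close> \<open>g \<in> D\<close> by (auto simp: differences_def)
  qed
  moreover have "inj_on ?f differences"
  proof (rule inj_onI)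
    fix y z assume yz: "y \<in> differences" "z \<in> differences" "?f y = ?f z"
    then have "y \<simeq> z"
      by (simp add: cong_add_lcancel flip: cong_def)
    moreover have "y mod int n = y" "z mod int n = z"
      using yz by (auto simp: differences_def)
    ultimately show "y = z"
      by (simp add: cong_def)
  qed
  ultimately have "?f ` differences = differences"
    using \<open>finite differences\<close> by (intro endo_inj_surj) auto
  then have "\<Sum>differences = (\<Sum>y\<in>differences. ?f y)"
    using \<open>inj_on ?f differences\<close> by (metis (no_types, lifting) sum.reindex_cong)
  also have "\<dots> \<simeq> (\<Sum>y\<in>differences. d - e + y)"
    by (rule cong_sum) (simp add: cong_def)
  also have "(\<Sum>y\<in>differences. d - e + y) = 7 * (d - e) + \<Sum>differences"
    by (simp add: sum.distrib card_differences)
  finally have "0 + \<Sum>differences \<simeq> 7 * (d - e) + \<Sum>differences"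
    by simp
  then show ?thesis
    unfolding cong_add_rcancel by (rule cong_sym)
qed

lemma n_cases:
  assumes "irreducible_cyclic n w"
  shows "n = 7 \<or> n = 21"
proof -
  have D: "int q1 \<in> D" "int q2 \<in> D" "q3 \<in> D"
    by (simp_all add: D_def)
  \<comment> \<open>As the increments sum to 0, the left-hand sides are \<open>21 * int q1\<close>
    and \<open>21 * int q2\<close>.\<close>
  have "7 * (int q1 - int q2) + 7 * (int q1 - q3) \<simeq> 0 + 0"
    "7 * (int q2 - int q1) + 7 * (int q2 - q3) \<simeq> 0 + 0"
    using D seven_difference by (intro cong_add; blast)+
  then have "int n dvd int (21 * q1)" "int n dvd int (21 * q2)"
    by (simp_all add: q3_def cong_0_iff algebra_simps)
  then have 21: "n dvd 21 * q1" "n dvd 21 * q2"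
    by (simp_all only: int_dvd_int_iff)
  then have "n dvd 21 * (q1 + q2)"
    by (simp add: distrib_left)
  then have "n dvd 21 * ((q1 + q2) mod n)"
    by (metis dvd_eq_mod_eq_0 mod_mult_right_eq)
  \<comment> \<open>Irreducibility says that \<open>n\<close> and the subscripts have greatest
    common divisor 1, so the factor 21 alone survives.\<close>
  then have "n dvd gcd (21 * n) (gcd (21 * q1) (21 * ((q1 + q2) mod n)))"
    using 21 by (intro gcd_greatest) simp_all
  also have "\<dots> = 21 * gcd n (gcd q1 ((q1 + q2) mod n))"
    by (simp only: gcd_mult_distrib_nat)
  also have "gcd n (gcd q1 ((q1 + q2) mod n)) = 1"
    using assms by (simp add: irreducible_cyclic_def)
  finally have "n dvd 21"
    by simp
  then obtain k where k: "21 = n * k"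
    by (elim dvdE)
  then have "7 * k \<le> 21"
    using n_ge_7 mult_le_mono1 by metis
  then consider "k = 0" | "k = 1" | "k = 2" | "k = 3"
    by linarith
  then show ?thesis
    by cases (use k in \<open>simp; presburger\<close>)+
qed

text \<open>Since the increments sum to 0, \<open>3 * d \<simeq> 0\<close> means that
  \<open>d + d\<close> is congruent to the sum of the other two increments, against
  \<open>sidon\<close>.\<close>

lemma D_nonzero: "\<not> 3 * int q1 \<simeq> 0" "\<not> 3 * int q2 \<simeq> 0" "\<not> 3 * q3 \<simeq> 0"
  and D_distinct: "\<not> int q1 \<simeq> int q2" "\<not> int q1 \<simeq> q3" "\<not> int q2 \<simeq> q3"
proof -
  have ne: "int q1 \<noteq> int q2" "int q1 \<noteq> q3" "int q2 \<noteq> q3"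
    using card_D by (auto simp: D_def card_insert_if split: if_splits)
  then show "\<not> int q1 \<simeq> int q2" "\<not> int q1 \<simeq> q3" "\<not> int q2 \<simeq> q3"
    using D_inj by (auto simp: D_def cong_def)
  have "\<not> int q1 + int q1 \<simeq> int q2 + q3" "\<not> int q2 + int q2 \<simeq> int q1 + q3" "\<not> q3 + q3 \<simeq> int q1 + int q2"
    using sidon[of "int q1" "int q1" "int q2" q3] sidon[of "int q2" "int q2" "int q1" q3]
      sidon[of q3 q3 "int q1" "int q2"] ne by (auto simp: D_def)
  then show "\<not> 3 * int q1 \<simeq> 0" "\<not> 3 * int q2 \<simeq> 0" "\<not> 3 * q3 \<simeq> 0"
    by (simp_all add: q3_def cong_iff_dvd_diff algebra_simps)
qed

end

section \<open>From residues back to triples, and the equivalence\<close>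

context cyclic_triple
begin

lemma residues_D:
  assumes "q2 < n"
  shows "(\<lambda>d. d mod int n) ` D = {int q1, int q2, (- int q1 - int q2) mod int n}"
  using assms q1_less by (simp add: D_def q3_def)

lemma difference_triple_if_perfect:
  assumes "h dvd n" "perfect_residues n h ((\<lambda>d. d mod int n) ` D)"
  shows "difference_triple n q1 q2 h"
proof -
  let ?E = "(\<lambda>d. d mod int n) ` D"
  note card_E = perfect_residuesD(1)[OF assms(2)] and const = perfect_residuesD(2)[OF assms(2)]
    and sidon = perfect_residuesD(3)[OF assms(2)] and cover = perfect_residuesD(4)[OF assms(2)]
  have "finite D" "card D \<le> 3"
    by (simp_all add: D_def card_insert_if)
  moreover have "card ?E \<le> card D"
    using \<open>finite D\<close> by (rule card_image_le)
  ultimately have card: "card D = 3"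
    using card_E by linarith
  \<comment> \<open>Three distinct residues leave no room for collisions in \<open>D\<close>, so
    equations between residues lift to the integers.\<close>
  then have inj: "inj_on (\<lambda>d. d mod int n) D"
    using \<open>finite D\<close> card_E by (intro eq_card_imp_inj_on) simp_all
  have mod_h: "x mod int n mod int h = x mod int h" for x
    using assms(1) by (simp add: mod_mod_cancel)
  show ?thesis
  proof
    fix d assume "d \<in> D"
    then have "d mod int n mod int h = int q1 mod int n mod int h"
      by (intro const imageI) (simp_all add: D_def)
    then show "[d = int q1] (mod int h)"
      by (simp add: mod_h cong_def)
  next
    fix a b c d assume D: "a \<in> D" "b \<in> D" "c \<in> D" "d \<in> D" "a + b \<simeq> c + d"
    then have "(a mod int n + b mod int n) mod int n = (c mod int n + d mod int n) mod int n"
      by (simp add: cong_def mod_simps)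
    moreover have "a mod int n \<in> ?E" "b mod int n \<in> ?E" "c mod int n \<in> ?E" "d mod int n \<in> ?E"
      using D by simp_all
    ultimately have "a mod int n = c mod int n \<or> a mod int n = d mod int n"
      by (intro sidon)
    then show "a = c \<or> a = d"
      using inj D by (auto simp: inj_on_def)
  next
    fix x :: int assume "[x = 0] (mod int h)"
    then have "x mod int n mod int h = 0"
      by (simp add: mod_h cong_def)
    moreover have "x mod int n \<in> {0..<int n}"
      using n_pos by simp
    ultimately have "\<exists>d\<in>?E. \<exists>e\<in>?E. x mod int n = (d - e) mod int n"
      by (intro cover)
    then obtain d e where "d \<in> D" "e \<in> D" "x mod int n = (d mod int n - e mod int n) mod int n"
      by blast
    then have "x \<simeq> d - e"
      by (simp only: cong_def mod_diff_eq)
    then show "\<exists>d\<in>D. \<exists>e\<in>D. x \<simeq> d - e"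
      using \<open>d \<in> D\<close> \<open>e \<in> D\<close> by blast
  qed (use assms(1) card in simp_all)
qed

end

lemma (in special_triple) special_cases:
  assumes "irreducible_cyclic n w" "q2 < n"
  shows "n = 7 \<and> {int q1, int q2, (- int q1 - int q2) mod 7} \<in> {{1, 2, 4}, {3, 5, 6}} \<or>
    n = 21 \<and> {int q1, int q2, (- int q1 - int q2) mod 21}
      \<in> {{1, 4, 16}, {2, 8, 11}, {5, 17, 20}, {10, 13, 19}}"
proof -
  define c where "c = (- int q1 - int q2) mod int n"
  have q: "int q1 \<in> {0..<int n}" "int q2 \<in> {0..<int n}" "int q1 mod int n = int q1" "int q2 mod int n = int q2"
    using assms(2) q1_less by simp_all
  have "c mod int n = c"
    by (simp add: c_def)
  have "3 * c mod int n = 3 * q3 mod int n"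
    by (simp add: c_def q3_def mod_simps)
  then have nz: "3 * int q1 mod int n \<noteq> 0" "3 * int q2 mod int n \<noteq> 0" "3 * c mod int n \<noteq> 0"
    using D_nonzero by (simp_all add: cong_def)
  have ne: "int q1 \<noteq> int q2" "int q1 \<noteq> c" "int q2 \<noteq> c"
    using D_distinct q unfolding cong_def c_def q3_def by simp_all
  consider "n = 7" | "n = 21"
    using n_cases assms(1) by blast
  then show ?thesis
  proof cases
    case 1
    then show ?thesis
      using residues_7[OF _ q(1,2) c_def ne nz] by (simp only: c_def of_nat_numeral refl simp_thms)
  next
    case 2
    have "7 * (int q1 - int q2) \<simeq> 0"
      by (intro seven_difference) (simp_all add: D_def)
    then have seven: "7 * (int q1 - int q2) mod int n = 0"
      unfolding cong_def by (rule trans) (rule mod_0)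
    \<comment> \<open>Otherwise 3 would divide \<open>q2\<close> too, because
      \<open>7 * (int q1 - int q2)\<close> is divisible by 21, and then 3 would divide
      \<open>n\<close> and every subscript, against irreducibility.\<close>
    have "\<not> 3 dvd int q1"
    proof
      assume "3 dvd int q1"
      then have "3 dvd int q2"
        using seven unfolding 2 of_nat_numeral by presburger
      then have "3 dvd q1" "3 dvd q2"
        using \<open>3 dvd int q1\<close> by presburger+
      then have "3 dvd gcd n (gcd q1 ((q1 + q2) mod n))"
        using 2 by (simp add: dvd_mod)
      also have "gcd n (gcd q1 ((q1 + q2) mod n)) = 1"
        using assms(1) by (simp add: irreducible_cyclic_def)
      finally show False
        by simp
    qed
    then show ?thesis
      using residues_21[OF _ q(1,2) c_def ne nz seven] 2 by (simp only: c_def of_nat_numeral refl simp_thms)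
  qed
qed

theorem corollary5p1:
  fixes n \<nu> q1 q2 :: nat and w :: "nat letter list"
  assumes "n \<ge> 1" and "\<nu> \<ge> 1" and "q1 < n" and "q2 < n"
    and "w = [(0, True), (q1, True), ((q1 + q2) mod n, True)]"
    and "irreducible_cyclic n w"
  shows "special_presentation 3 3 \<nu> (cyclic_presentation n w) \<longleftrightarrow>
      (n = 7 \<and> \<nu> = 1 \<and>
        {int q1, int q2, (- int q1 - int q2) mod 7} \<in> {{1, 2, 4}, {3, 5, 6}}) \<or>
      (n = 21 \<and> \<nu> = 3 \<and>
        {int q1, int q2, (- int q1 - int q2) mod 21}
          \<in> {{1, 4, 16}, {2, 8, 11}, {5, 17, 20}, {10, 13, 19}})"
proof -
  let ?S7 = "{int q1, int q2, (- int q1 - int q2) mod 7} \<in> {{1, 2, 4}, {3, 5, 6}}"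
  let ?S21 = "{int q1, int q2, (- int q1 - int q2) mod 21}
    \<in> {{1, 4, 16}, {2, 8, 11}, {5, 17, 20}, {10, 13, 19}}"
  interpret cyclic_triple n q1 q2
    by unfold_locales fact
  have 7: "special_presentation 3 3 \<nu> (cyclic_presentation n w) \<longleftrightarrow> \<nu> = 1" if "n = 7" ?S7
  proof -
    have "perfect_residues n 1 ((\<lambda>d. d mod int n) ` D)"
      using bspec[OF perfect_residues_7 that(2)] that(1) residues_D[OF assms(4)] by simp
    then interpret difference_triple n q1 q2 1
      by (intro difference_triple_if_perfect) simp_all
    show ?thesis
      unfolding assms(5) by (rule special_P)
  qed
  have 21: "special_presentation 3 3 \<nu> (cyclic_presentation n w) \<longleftrightarrow> \<nu> = 3" if "n = 21" ?S21
  proof -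
    have "perfect_residues n 3 ((\<lambda>d. d mod int n) ` D)"
      using bspec[OF perfect_residues_21 that(2)] that(1) residues_D[OF assms(4)] by simp
    then interpret difference_triple n q1 q2 3
      by (intro difference_triple_if_perfect) (simp_all add: that)
    show ?thesis
      unfolding assms(5) by (rule special_P)
  qed
  have cases: "n = 7 \<and> ?S7 \<or> n = 21 \<and> ?S21" if "special_presentation 3 3 \<nu> (cyclic_presentation n w)"
  proof -
    interpret special_triple n q1 q2 \<nu>
      using that unfolding assms(5) by unfold_locales
    show ?thesis
      using assms(6)[unfolded assms(5)] assms(4) by (rule special_cases)
  qed
  \<comment> \<open>The propositional combination is stated for abstract propositions, so that the
    set memberships stay opaque.\<close>
  have "S \<longleftrightarrow> N \<and> \<nu> = 1 \<and> A \<or> M \<and> \<nu> = 3 \<and> B"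
    if "S \<Longrightarrow> N \<and> A \<or> M \<and> B" "N \<Longrightarrow> A \<Longrightarrow> S \<longleftrightarrow> \<nu> = 1" "M \<Longrightarrow> B \<Longrightarrow> S \<longleftrightarrow> \<nu> = 3" for S N A M B
    using that by blast
  note this[OF cases 7 21]
  then show ?thesis .
qed

end
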